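(* Let $\mathbf M=(M,\mathcal B,\mu)$ be a structure of integral logic and let $\phi(x,y)$ be a formula which is almost dependent in $\mathbf M$; put $\tilde\phi(y,x)=\phi(x,y)$. Then every $p\in S_\phi(M)$ is almost definable by an almost $\tilde\phi$-definable relation $\psi(y)$ over $M$, i.e. $\phi(p,b)=\psi(b)$ for $\mu$-almost all $b\in M$; moreover such $\psi$ is unique up to $\mu_{\tilde\phi}$-null sets.
   Context: Integral logic: formulas are built from atomic formulas by real linear combinations, products, absolute value and integration $\int\phi\,dx$; a structure is a probability space $(M,\mathcal B,\mu)$ interpreting relation symbols as bounded measurable functions, and formulas are interpreted as bounded measurable functions ($b_\phi$ denotes the bound of $\phi$), with $(\int\phi(\bar x,y)dy)^{\mathbf M}(\bar a)=\int\phi^{\mathbf M}(\bar a,y)d\mu(y)$. $\mathbf M\preceq\mathbf N$ means $M\subseteq N$, $\mathbf M$ has the subspace measure and formulas agree on tuples from $M$. Almost dependence: let $A=\{\phi^{\mathbf M}(\cdot,b),\ \phi^{\mathbf M}(a,\cdot): a,b\in M\}$, a set of real functions on $M$. For measurable $E\subseteq M$, reals $s<r$ and $k\ge1$ let $D_k(A,E,s,r)=\bigcup_{f\in A}\{w\in E^{2k}: f(w_{2i})\le s,\ f(w_{2i+1})\ge r\ \text{for } i<k\}$. $\phi$ is almost dependent in $\mathbf M$ if whenever $E\subseteq M$ is measurable with $\mu(E)>0$ and $s<r$, there is $k\ge1$ with $(\mu^{2k})^*(D_k(A,E,s,r))<\mu(E)^{2k}$, where $(\mu^{2k})^*$ is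 the outer measure of the product measure. Types: for $\mathbf N\succeq\mathbf M$ and $a\in N$, $\mathrm{tp}_\phi(a/M)$ is the function $b\mapsto\phi^{\mathbf N}(a,b)$ on $M$; $S_\phi(M)$ is the set of these ($\phi(p,b)$ denotes the value of $p$ at $b$), a compact Hausdorff space under the weakest topology making each $p\mapsto\phi(p,b)$ continuous. $S_{\tilde\phi}(M)$ is defined symmetrically (types in $y$), with each $b\in M$ identified with its realized type, so $M\subseteq S_{\tilde\phi}(M)$. $\mu_{\tilde\phi}$ denotes the Radon probability measure on $S_{\tilde\phi}(M)$ induced by $\mathbf M$: the unique Radon measure such that, for each function $g$ in the Riesz space generated by the functions $q\mapsto\phi(a,q)$ ($a\in M$), the set $\{q:g(q)>0\}$ has measure $\mu\{b\in M: g(b)>0\}$. An almost $\tilde\phi$-definable relation over $M$ is a $\mu_{\tilde\phi}$-measurable function $\psi$ on $S_{\tilde\phi}(M)$ for which there is a sequence of continuous $g_n:S_{\tilde\phi}(M)\to\mathbb R$ with $|g_n|\le b_\phi$ and $g_n\to\psi$ $\mu_{\tilde\phi}$-almost everywhere.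
   Formalization: Types are restricted to those finitely approximable in M (pointwise closure of realised types); the Riesz space also contains the constant 1; for an almost φ̃-definable ψ, g_n→ψ is required also μ-a.e. on M. Without these the claim, μ_φ̃ or uniqueness fails. *)

theory Defs
  imports "HOL-Probability.Probability"
begin

section \<open>Integral logic\<close>

record 'r language =
  arity :: "'r \<Rightarrow> nat"
  bnd :: "'r \<Rightarrow> real"

datatype 'r formula =
    One
  | Atom 'r "nat list"
  | Add "'r formula" "'r formula"
  | Scale real "'r formula"
  | Mult "'r formula" "'r formula"
  | Abs "'r formula"
  | Integ nat "'r formula"

primrec is_formula :: "'r language \<Rightarrow> 'r formula \<Rightarrow> bool" where
  "is_formula L One \<longleftrightarrow> True"
| "is_formula L (Atom R vs) \<longleftrightarrow> length vs = arity L R"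
| "is_formula L (Add \<phi> \<theta>) \<longleftrightarrow> is_formula L \<phi> \<and> is_formula L \<theta>"
| "is_formula L (Scale c \<phi>) \<longleftrightarrow> is_formula L \<phi>"
| "is_formula L (Mult \<phi> \<theta>) \<longleftrightarrow> is_formula L \<phi> \<and> is_formula L \<theta>"
| "is_formula L (Abs \<phi>) \<longleftrightarrow> is_formula L \<phi>"
| "is_formula L (Integ z \<phi>) \<longleftrightarrow> is_formula L \<phi>"

primrec free_vars :: "'r formula \<Rightarrow> nat set" where
  "free_vars One = {}"
| "free_vars (Atom R vs) = set vs"
| "free_vars (Add \<phi> \<theta>) = free_vars \<phi> \<union> free_vars \<theta>"
| "free_vars (Scale c \<phi>) = free_vars \<phi>"
| "free_vars (Mult \<phi> \<theta>) = free_vars \<phi> \<union> free_vars \<theta>"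
| "free_vars (Abs \<phi>) = free_vars \<phi>"
| "free_vars (Integ z \<phi>) = free_vars \<phi> - {z}"

primrec bound :: "'r language \<Rightarrow> 'r formula \<Rightarrow> real" where
  "bound L One = 1"
| "bound L (Atom R vs) = bnd L R"
| "bound L (Add \<phi> \<theta>) = bound L \<phi> + bound L \<theta>"
| "bound L (Scale c \<phi>) = \<bar>c\<bar> * bound L \<phi>"
| "bound L (Mult \<phi> \<theta>) = bound L \<phi> * bound L \<theta>"
| "bound L (Abs \<phi>) = bound L \<phi>"
| "bound L (Integ z \<phi>) = bound L \<phi>"

record ('r, 'm) struc =
  meas :: "'m measure"
  rel :: "'r \<Rightarrow> (nat \<Rightarrow> 'm) \<Rightarrow> real"

abbreviation universe :: "('r, 'm) struc \<Rightarrow> 'm set" where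
  "universe M \<equiv> space (meas M)"

definition is_struc :: "'r language \<Rightarrow> ('r, 'm) struc \<Rightarrow> bool" where
  "is_struc L M \<longleftrightarrow> prob_space (meas M) \<and>
     (\<forall>R. rel M R \<in> borel_measurable (Pi\<^sub>M {..<arity L R} (\<lambda>_. meas M)) \<and>
          (\<forall>t \<in> {..<arity L R} \<rightarrow>\<^sub>E universe M. \<bar>rel M R t\<bar> \<le> bnd L R))"

primrec eval :: "('r, 'm) struc \<Rightarrow> 'r formula \<Rightarrow> (nat \<Rightarrow> 'm) \<Rightarrow> real" where
  "eval M One v = 1"
| "eval M (Atom R vs) v = rel M R (\<lambda>i\<in>{..<length vs}. v (vs ! i))"
| "eval M (Add \<phi> \<theta>) v = eval M \<phi> v + eval M \<theta> v"
| "eval M (Scale c \<phi>) v = c * eval M \<phi> v"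
| "eval M (Mult \<phi> \<theta>) v = eval M \<phi> v * eval M \<theta> v"
| "eval M (Abs \<phi>) v = \<bar>eval M \<phi> v\<bar>"
| "eval M (Integ z \<phi>) v = (\<integral>a. eval M \<phi> (v(z := a)) \<partial>meas M)"

text \<open>
  The value of \<open>\<phi>(x, y)\<close> at \<open>x = a\<close>, \<open>y = b\<close>, for distinct variables with
  \<open>free_vars \<phi> \<subseteq> {x, y}\<close>. The formula \<open>\<phi>\<close> with its two variables in the opposite order
  is obtained by exchanging the arguments \<open>x\<close> and \<open>y\<close>, here and in all notions below.
\<close>

definition val :: "('r, 'm) struc \<Rightarrow> nat \<Rightarrow> nat \<Rightarrow> 'r formula \<Rightarrow> 'm \<Rightarrow> 'm \<Rightarrow> real" where
  "val M x y \<phi> a b = eval M \<phi> ((\<lambda>_. b)(x := a))"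

text \<open>
  Elementary extension, with \<open>M\<close> identified with its image under \<open>e\<close>. The two conditions
  in the middle say that \<open>meas M\<close> is the subspace measure (on a not necessarily measurable
  subset): traces of measurable sets, measured by the outer measure of \<open>N\<close>.
\<close>

definition elem_ext ::
  "'r language \<Rightarrow> ('m \<Rightarrow> 'n) \<Rightarrow> ('r, 'm) struc \<Rightarrow> ('r, 'n) struc \<Rightarrow> bool" where
  "elem_ext L e M N \<longleftrightarrow> is_struc L N \<and>
     inj_on e (universe M) \<and> e ` universe M \<subseteq> universe N \<and>
     sets (meas M) = {e -` X \<inter> universe M | X. X \<in> sets (meas N)} \<and>
     (\<forall>A \<in> sets (meas M). emeasure (meas M) A = outer_measure_of (meas N) (e ` A)) \<and>
     (\<forall>\<phi> v. is_formula L \<phi> \<and> (\<forall>n. v n \<in> universe M) \<longrightarrow>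
        eval N \<phi> (\<lambda>n. e (v n)) = eval M \<phi> v)"

section \<open>Almost dependence\<close>

definition sections :: "('r, 'm) struc \<Rightarrow> nat \<Rightarrow> nat \<Rightarrow> 'r formula \<Rightarrow> ('m \<Rightarrow> real) set" where
  "sections M x y \<phi> = {\<lambda>a. val M x y \<phi> a b | b. b \<in> universe M} \<union>
                      {\<lambda>b. val M x y \<phi> a b | a. a \<in> universe M}"

definition D :: "nat \<Rightarrow> ('m \<Rightarrow> real) set \<Rightarrow> 'm set \<Rightarrow> real \<Rightarrow> real \<Rightarrow> (nat \<Rightarrow> 'm) set" where
  "D k A E s r = (\<Union>f\<in>A. {w \<in> {..<2 * k} \<rightarrow>\<^sub>E E.
      \<forall>i<k. f (w (2 * i)) \<le> s \<and> r \<le> f (w (2 * i + 1))})"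

definition almost_dependent :: "('r, 'm) struc \<Rightarrow> nat \<Rightarrow> nat \<Rightarrow> 'r formula \<Rightarrow> bool" where
  "almost_dependent M x y \<phi> \<longleftrightarrow>
     (\<forall>E \<in> sets (meas M). \<forall>s r. emeasure (meas M) E > 0 \<and> s < r \<longrightarrow>
        (\<exists>k\<ge>1. outer_measure_of (Pi\<^sub>M {..<2 * k} (\<lambda>_. meas M)) (D k (sections M x y \<phi>) E s r)
               < emeasure (meas M) E ^ (2 * k)))"

section \<open>Types\<close>

definition tp ::
  "('m \<Rightarrow> 'n) \<Rightarrow> ('r, 'm) struc \<Rightarrow> ('r, 'n) struc \<Rightarrow> nat \<Rightarrow> nat \<Rightarrow> 'r formula \<Rightarrow> 'n \<Rightarrow> 'm \<Rightarrow> real" where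
  "tp e M N x y \<phi> a = (\<lambda>b \<in> universe M. val N x y \<phi> a (e b))"

abbreviation rtp :: "('r, 'm) struc \<Rightarrow> nat \<Rightarrow> nat \<Rightarrow> 'r formula \<Rightarrow> 'm \<Rightarrow> 'm \<Rightarrow> real" where
  "rtp M x y \<phi> a \<equiv> tp id M M x y \<phi> a"

text \<open>
  Elementarity does not see null sets: for an atomic \<open>\<phi>\<close>, adding a single point \<open>a\<close> of measure
  zero to \<open>M\<close> gives an elementary extension in which \<open>\<phi>(a, \<cdot>)\<close> is any prescribed measurable
  function within the bound. A point \<open>a\<close> of \<open>N\<close> contributes a type only if it is
  approximated by points of \<open>M\<close> in the following sense. This holds in particular if the sets
  \<open>{a' \<in> N. \<forall>b\<in>F. \<bar>\<phi>(a, b) - \<phi>(a', b)\<bar> < \<epsilon>}\<close>, for finite \<open>F \<subseteq> M\<close>, are not null.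
\<close>

definition approximated ::
  "('m \<Rightarrow> 'n) \<Rightarrow> ('r, 'm) struc \<Rightarrow> ('r, 'n) struc \<Rightarrow> nat \<Rightarrow> nat \<Rightarrow> 'r formula \<Rightarrow> 'n \<Rightarrow> bool" where
  "approximated e M N x y \<phi> a \<longleftrightarrow>
     (\<forall>F \<epsilon>. finite F \<and> F \<subseteq> universe M \<and> \<epsilon> > 0 \<longrightarrow>
        (\<exists>a' \<in> universe M. \<forall>b\<in>F. \<bar>tp e M N x y \<phi> a b - rtp M x y \<phi> a' b\<bar> < \<epsilon>))"

text \<open>
  Types are represented by functions that are \<open>undefined\<close> off the universe, so that the product
  topology is the topology of pointwise convergence on \<open>M\<close>. Extensions \<open>N\<close> on
  the type \<open>'m option\<close> (one new point) suffice: a type realised in some extension \<open>N\<close> is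
  realised in the elementary substructure \<open>M \<union> {a}\<close>; see also \<open>tp_in_types\<close> below.
  The closure makes the space of types compact: in general a pointwise limit of types is only realised
  in an ultrapower, which need not induce the measure of \<open>M\<close> on \<open>M\<close>. Altogether this is the
  pointwise closure of the types realised in \<open>M\<close> (\<open>types_eq_closure_realised\<close>).
\<close>

definition types ::
  "'r language \<Rightarrow> ('r, 'm) struc \<Rightarrow> nat \<Rightarrow> nat \<Rightarrow> 'r formula \<Rightarrow> ('m \<Rightarrow> real) set" where
  "types L M x y \<phi> = product_topology (\<lambda>_. euclideanreal) (universe M) closure_of
     {tp Some M N x y \<phi> a | (N :: ('r, 'm option) struc) a.
        elem_ext L Some M N \<and> a \<in> universe N \<and> approximated Some M N x y \<phi> a}"

definition type_top ::
  "'r language \<Rightarrow> ('r, 'm) struc \<Rightarrow> nat \<Rightarrow> nat \<Rightarrow> 'r formula \<Rightarrow> ('m \<Rightarrow> real) topology" where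
  "type_top L M x y \<phi> =
     subtopology (product_topology (\<lambda>_. euclideanreal) (universe M)) (types L M x y \<phi>)"

section \<open>The induced measure and definability\<close>

text \<open>
  The unit is included among the generators: without it the measures of the sets \<open>{q. g q > 0}\<close>
  do not determine a Radon measure (the functions \<open>g\<close> would all be positively homogeneous).
\<close>

inductive_set riesz :: "('a \<Rightarrow> real) set \<Rightarrow> ('a \<Rightarrow> real) set" for G where
  gen: "g \<in> G \<Longrightarrow> g \<in> riesz G"
| unit: "(\<lambda>_. 1) \<in> riesz G"
| add: "g \<in> riesz G \<Longrightarrow> h \<in> riesz G \<Longrightarrow> (\<lambda>q. g q + h q) \<in> riesz G"
| scale: "g \<in> riesz G \<Longrightarrow> (\<lambda>q. c * g q) \<in> riesz G"
| sup: "g \<in> riesz G \<Longrightarrow> h \<in> riesz G \<Longrightarrow> (\<lambda>q. max (g q) (h q)) \<in> riesz G"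

definition radon_prob :: "'a topology \<Rightarrow> 'a measure \<Rightarrow> bool" where
  "radon_prob T \<nu> \<longleftrightarrow> prob_space \<nu> \<and> space \<nu> = topspace T \<and>
     sets \<nu> = sigma_sets (topspace T) {U. openin T U} \<and>
     (\<forall>B \<in> sets \<nu>. emeasure \<nu> B = (SUP K \<in> {K \<in> sets \<nu>. compactin T K \<and> K \<subseteq> B}. emeasure \<nu> K))"

text \<open>
  \<open>induced_measure L M x y \<phi> \<nu>\<close>: \<open>\<nu>\<close> is the measure induced by \<open>M\<close> on the types in \<open>x\<close>.
  The value at \<open>q\<close> of the parameter \<open>b\<close> is \<open>q b\<close>, and \<open>a \<in> M\<close> is identified with \<open>rtp M x y \<phi> a\<close>.
\<close>

definition induced_measure ::
  "'r language \<Rightarrow> ('r, 'm) struc \<Rightarrow> nat \<Rightarrow> nat \<Rightarrow> 'r formula \<Rightarrow> ('m \<Rightarrow> real) measure \<Rightarrow> bool" where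
  "induced_measure L M x y \<phi> \<nu> \<longleftrightarrow> radon_prob (type_top L M x y \<phi>) \<nu> \<and>
     (\<forall>g \<in> riesz {\<lambda>q. q b | b. b \<in> universe M}.
        emeasure \<nu> {q \<in> types L M x y \<phi>. g q > 0} =
        emeasure (meas M) {a \<in> universe M. g (rtp M x y \<phi> a) > 0})"

text \<open>
  Almost definable relations on the types in \<open>x\<close>. The convergence is also required almost everywhere
  on \<open>M\<close>, since \<open>\<psi>\<close> is going to be evaluated at the points of \<open>M\<close>: the set of realised types
  may well be a \<open>\<nu>\<close>-null set, and then the convergence \<open>\<nu>\<close>-almost everywhere says
  nothing about \<open>\<psi>\<close> on \<open>M\<close>. An example is \<open>\<phi>(x, y) = (if x = y then 1 else 0)\<close> on the unit interval, where
  \<open>\<nu>\<close> is concentrated at the zero type.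
\<close>

definition almost_definable_rel ::
  "'r language \<Rightarrow> ('r, 'm) struc \<Rightarrow> nat \<Rightarrow> nat \<Rightarrow> 'r formula \<Rightarrow> ('m \<Rightarrow> real) measure \<Rightarrow>
   (('m \<Rightarrow> real) \<Rightarrow> real) \<Rightarrow> bool" where
  "almost_definable_rel L M x y \<phi> \<nu> \<psi> \<longleftrightarrow> \<psi> \<in> borel_measurable (completion \<nu>) \<and>
     (\<exists>g :: nat \<Rightarrow> ('m \<Rightarrow> real) \<Rightarrow> real.
        (\<forall>n. continuous_map (type_top L M x y \<phi>) euclideanreal (g n) \<and>
             (\<forall>q \<in> types L M x y \<phi>. \<bar>g n q\<bar> \<le> bound L \<phi>)) \<and>
        (AE q in \<nu>. (\<lambda>n. g n q) \<longlonglongrightarrow> \<psi> q) \<and>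
        (AE a in meas M. (\<lambda>n. g n (rtp M x y \<phi> a)) \<longlonglongrightarrow> \<psi> (rtp M x y \<phi> a)))"

section \<open>Basic facts on types\<close>

lemma in_closure_product_real:
  "p \<in> product_topology (\<lambda>_. euclideanreal) I closure_of S \<longleftrightarrow>
     p \<in> extensional I \<and>
     (\<forall>F \<epsilon>. finite F \<and> F \<subseteq> I \<and> \<epsilon> > 0 \<longrightarrow> (\<exists>q \<in> S \<inter> extensional I. \<forall>i\<in>F. \<bar>p i - q i\<bar> < \<epsilon>))"
  (is "?L \<longleftrightarrow> ?R")
proof
  assume L: ?L
  show ?R
  proof (intro conjI allI impI)
    show "p \<in> extensional I" using L by (auto simp: in_closure_of PiE_def)
    fix F :: "'a set" and \<epsilon> :: real assume F: "finite F \<and> F \<subseteq> I \<and> \<epsilon> > 0"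
    let ?U = "Pi\<^sub>E I (\<lambda>i. if i \<in> F then ball (p i) \<epsilon> else UNIV)"
    have "openin (product_topology (\<lambda>_. euclideanreal) I) ?U"
      unfolding openin_PiE_gen
      by (rule disjI2) (use F in \<open>auto intro: finite_subset[of _ F] split: if_splits\<close>)
    moreover have "p \<in> ?U" using L F by (auto simp: in_closure_of PiE_def extensional_def)
    ultimately obtain q where "q \<in> S" "q \<in> ?U" using L unfolding in_closure_of by blast
    then have "q \<in> S \<inter> extensional I" "\<forall>i\<in>F. \<bar>p i - q i\<bar> < \<epsilon>"
      using F by (auto simp: PiE_def Pi_def dist_real_def split: if_splits)
    then show "\<exists>q \<in> S \<inter> extensional I. \<forall>i\<in>F. \<bar>p i - q i\<bar> < \<epsilon>" by blast
  qed
next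
  assume R: ?R
  show ?L
    unfolding in_closure_of
  proof (intro conjI allI impI)
    show "p \<in> topspace (product_topology (\<lambda>_. euclideanreal) I)" using R by (auto simp: PiE_def)
    fix T assume T: "p \<in> T \<and> openin (product_topology (\<lambda>_. euclideanreal) I) T"
    then obtain U where U: "finite {i \<in> I. U i \<noteq> UNIV}" "\<forall>i\<in>I. open (U i)" "p \<in> Pi\<^sub>E I U" "Pi\<^sub>E I U \<subseteq> T"
      unfolding openin_product_topology_alt by auto
    let ?F = "{i \<in> I. U i \<noteq> UNIV}"
    have "\<forall>i\<in>?F. \<exists>\<epsilon>>0. ball (p i) \<epsilon> \<subseteq> U i"
      using U(2,3) by (auto simp: open_contains_ball PiE_def Pi_def)
    then obtain \<delta> where \<delta>: "\<And>i. i \<in> ?F \<Longrightarrow> \<delta> i > 0 \<and> ball (p i) (\<delta> i) \<subseteq> U i" by metis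
    define \<epsilon> where "\<epsilon> = Min (insert 1 (\<delta> ` ?F))"
    have e: "\<epsilon> > 0" using U(1) \<delta> by (auto simp: \<epsilon>_def)
    have e2: "\<epsilon> \<le> \<delta> i" if "i \<in> ?F" for i using U(1) that by (auto simp: \<epsilon>_def)
    obtain q where q: "q \<in> S" "q \<in> extensional I" "\<forall>i\<in>?F. \<bar>p i - q i\<bar> < \<epsilon>"
      using R e U(1) by (metis (no_types, lifting) Int_iff mem_Collect_eq subsetI)
    have "q i \<in> U i" if "i \<in> I" for i
    proof (cases "U i = UNIV")
      case False
      then have "q i \<in> ball (p i) (\<delta> i)" using q(3) e2[of i] that by (force simp: dist_real_def)
      then show ?thesis using \<delta>[of i] False that by blast
    qed simp
    then have "q \<in> Pi\<^sub>E I U" using q(2) by (auto simp: PiE_def)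
    then show "\<exists>y. y \<in> S \<and> y \<in> T" using U(4) q(1) by blast
  qed
qed

lemma elem_ext_copy:
  fixes M :: "('r, 'm) struc"
  assumes M: "is_struc L M"
  defines "N \<equiv> \<lparr>meas = embed_measure (meas M) Some,
                rel = \<lambda>R t. rel M R (\<lambda>i\<in>{..<arity L R}. the (t i))\<rparr>"
  shows "elem_ext L Some M N"
    and "\<And>\<phi> v. is_formula L \<phi> \<Longrightarrow> eval N \<phi> (\<lambda>n. Some (v n)) = eval M \<phi> v"
proof -
  interpret prob_space "meas M" using M by (simp add: is_struc_def)
  have Some1: "inj (Some :: 'm \<Rightarrow> 'm option)" by simp
  have sp: "universe N = Some ` universe M" by (simp add: N_def space_embed_measure)
  have the_meas [measurable]: "the \<in> embed_measure (meas M) Some \<rightarrow>\<^sub>M meas M"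
    by (rule measurable_embed_measure1) (simp add: comp_def)
  have struc: "is_struc L N"
    unfolding is_struc_def
  proof (intro conjI allI ballI)
    have "emeasure (embed_measure (meas M) Some) (Some ` space (meas M)) = 1"
      by (simp add: emeasure_embed_measure_image emeasure_space_1)
    then show "prob_space (meas N)"
      by (intro prob_spaceI) (simp add: N_def space_embed_measure)
    fix R
    have R: "rel M R \<in> borel_measurable (Pi\<^sub>M {..<arity L R} (\<lambda>_. meas M))"
      "\<And>t. t \<in> {..<arity L R} \<rightarrow>\<^sub>E universe M \<Longrightarrow> \<bar>rel M R t\<bar> \<le> bnd L R"
      using M by (auto simp: is_struc_def)
    have "(\<lambda>t. \<lambda>i\<in>{..<arity L R}. the (t i)) \<in>
        Pi\<^sub>M {..<arity L R} (\<lambda>_. embed_measure (meas M) Some) \<rightarrow>\<^sub>M Pi\<^sub>M {..<arity L R} (\<lambda>_. meas M)"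
      by measurable
    from measurable_compose[OF this R(1)]
    show "rel N R \<in> borel_measurable (Pi\<^sub>M {..<arity L R} (\<lambda>_. meas N))"
      by (simp add: N_def)
    fix t assume "t \<in> {..<arity L R} \<rightarrow>\<^sub>E universe N"
    then have "(\<lambda>i\<in>{..<arity L R}. the (t i)) \<in> {..<arity L R} \<rightarrow>\<^sub>E universe M"
      by (force simp: sp PiE_def Pi_def)
    from R(2)[OF this] show "\<bar>rel N R t\<bar> \<le> bnd L R" by (simp add: N_def)
  qed
  show ev: "eval N \<phi> (\<lambda>n. Some (v n)) = eval M \<phi> v" if "is_formula L \<phi>" for \<phi> v
    using that
  proof (induction \<phi> arbitrary: v)
    case (Atom R vs)
    have "(\<lambda>i\<in>{..<arity L R}. the ((\<lambda>i\<in>{..<arity L R}. Some (v (vs ! i))) i)) =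
          (\<lambda>i\<in>{..<arity L R}. v (vs ! i))"
      by (auto simp: restrict_def)
    with Atom show ?case by (simp add: N_def)
  next
    case (Integ z \<phi>)
    have "(\<lambda>n. Some (v n))(z := Some a) = (\<lambda>n. Some ((v(z := a)) n))" for a by auto
    then have *: "eval N \<phi> ((\<lambda>n. Some (v n))(z := Some a)) = eval M \<phi> (v(z := a))" for a
      using Integ.IH[of "v(z := a)"] Integ.prems by (simp only: is_formula.simps)
    define h where "h = (\<lambda>a. eval M \<phi> (v(z := a)))"
    define g where "g = (\<lambda>a. eval N \<phi> ((\<lambda>n. Some (v n))(z := a)))"
    have gh: "g (Some a) = h a" for a using * by (simp add: g_def h_def)
    have "(\<integral>a. g a \<partial>embed_measure (meas M) Some) = (\<integral>a. h a \<partial>meas M)"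
    proof (cases "h \<in> borel_measurable (meas M)")
      case True
      then have g: "g \<in> borel_measurable (embed_measure (meas M) Some)"
        using gh by (intro measurable_embed_measure1) simp
      have "(\<integral>a. g a \<partial>distr (meas M) (embed_measure (meas M) Some) Some) = (\<integral>a. g (Some a) \<partial>meas M)"
        by (rule integral_distr[OF measurable_embed_measure2[OF Some1] g])
      then show ?thesis
        by (simp only: embed_measure_eq_distr[OF Some1, symmetric] gh)
    next
      case False
      have "g \<notin> borel_measurable (embed_measure (meas M) Some)"
        using measurable_compose[OF measurable_embed_measure2[OF Some1, of "meas M"], of g borel] False
        by (auto simp: gh)
      then show ?thesis using False
        by (metis borel_measurable_integrable not_integrable_integral_eq)
    qed
    then show ?case by (simp add: g_def h_def N_def)
  qed auto
  show "elem_ext L Some M N"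
    unfolding elem_ext_def
  proof (intro conjI struc ballI allI impI)
    show "inj_on Some (universe M)" by simp
    show "Some ` universe M \<subseteq> universe N" by (simp add: sp)
    show "sets (meas M) = {Some -` X \<inter> universe M |X. X \<in> sets (meas N)}"
    proof (intro equalityI subsetI)
      fix A assume A: "A \<in> sets (meas M)"
      have "A = Some -` (Some ` A) \<inter> universe M" using sets.sets_into_space[OF A] by auto
      moreover have "Some ` A \<in> sets (meas N)" using A by (simp add: N_def in_sets_embed_measure)
      ultimately show "A \<in> {Some -` X \<inter> universe M |X. X \<in> sets (meas N)}" by blast
    next
      fix A assume "A \<in> {Some -` X \<inter> universe M |X. X \<in> sets (meas N)}"
      then show "A \<in> sets (meas M)"
        using measurable_sets[OF measurable_embed_measure2[OF Some1, of "meas M"]] by (auto simp: N_def)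
    qed
    fix A assume A: "A \<in> sets (meas M)"
    then show "emeasure (meas M) A = outer_measure_of (meas N) (Some ` A)"
      by (simp add: N_def outer_measure_of_eq in_sets_embed_measure emeasure_embed_measure_image)
  qed (use ev in blast)
qed

lemma rtp_in_types:
  assumes M: "is_struc L M" and \<phi>: "is_formula L \<phi>" and a: "a \<in> universe M"
  shows "rtp M x y \<phi> a \<in> types L M x y \<phi>"
proof -
  obtain N :: "('a, 'b option) struc" where N: "elem_ext L Some M N"
    "\<And>v. eval N \<phi> (\<lambda>n. Some (v n)) = eval M \<phi> v"
    using elem_ext_copy[OF M] \<phi> by blast
  have "(\<lambda>_. Some b)(x := Some a) = (\<lambda>n. Some (((\<lambda>_. b)(x := a)) n))" for b by auto
  then have "eval N \<phi> ((\<lambda>_. Some b)(x := Some a)) = eval M \<phi> ((\<lambda>_. b)(x := a))" for b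
    using N(2)[of "(\<lambda>_. b)(x := a)"] by simp
  then have eq: "tp Some M N x y \<phi> (Some a) = rtp M x y \<phi> a"
    by (auto simp: tp_def val_def restrict_def)
  have "approximated Some M N x y \<phi> (Some a)"
    unfolding approximated_def eq using a by force
  moreover have "Some a \<in> universe N" using N(1) a by (auto simp: elem_ext_def)
  ultimately have "tp Some M N x y \<phi> (Some a) \<in> {tp Some M N x y \<phi> a | (N :: ('a, 'b option) struc) a.
        elem_ext L Some M N \<and> a \<in> universe N \<and> approximated Some M N x y \<phi> a}"
    using N(1) by blast
  then show ?thesis
    unfolding types_def eq
    by (rule subsetD[OF closure_of_subset, rotated]) (auto simp: tp_def)
qed

lemma tp_in_closure_realised:
  assumes "approximated e M N x y \<phi> a"
  shows "tp e M N x y \<phi> a \<in>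
    product_topology (\<lambda>_. euclideanreal) (universe M) closure_of (rtp M x y \<phi> ` universe M)"
  unfolding in_closure_product_real
proof (intro conjI allI impI)
  show "tp e M N x y \<phi> a \<in> extensional (universe M)" by (simp add: tp_def)
  fix F :: "'a set" and \<epsilon> :: real assume "finite F \<and> F \<subseteq> universe M \<and> \<epsilon> > 0"
  then obtain a' where "a' \<in> universe M" "\<forall>b\<in>F. \<bar>tp e M N x y \<phi> a b - rtp M x y \<phi> a' b\<bar> < \<epsilon>"
    using assms unfolding approximated_def by blast
  moreover have "rtp M x y \<phi> a' \<in> extensional (universe M)" by (simp add: tp_def)
  ultimately show "\<exists>q \<in> rtp M x y \<phi> ` universe M \<inter> extensional (universe M).
      \<forall>b\<in>F. \<bar>tp e M N x y \<phi> a b - q b\<bar> < \<epsilon>" by blast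
qed

lemma types_eq_closure_realised:
  assumes M: "is_struc L M" and \<phi>: "is_formula L \<phi>"
  shows "types L M x y \<phi> =
    product_topology (\<lambda>_. euclideanreal) (universe M) closure_of (rtp M x y \<phi> ` universe M)"
    (is "_ = ?T closure_of ?Z")
proof
  show "types L M x y \<phi> \<subseteq> ?T closure_of ?Z"
    unfolding types_def
    by (rule closure_of_minimal) (auto intro: tp_in_closure_realised)
  show "?T closure_of ?Z \<subseteq> types L M x y \<phi>"
  proof (rule closure_of_minimal)
    show "?Z \<subseteq> types L M x y \<phi>" using rtp_in_types[OF M \<phi>] by blast
    show "closedin ?T (types L M x y \<phi>)" by (simp add: types_def)
  qed
qed

lemma tp_in_types:
  assumes "is_struc L M" "is_formula L \<phi>" "elem_ext L e M N" "approximated e M N x y \<phi> a"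
  shows "tp e M N x y \<phi> a \<in> types L M x y \<phi>"
  using assms by (simp add: types_eq_closure_realised tp_in_closure_realised)

end

theory Submission
  imports Defs
begin

text \<open>
  Almost dependence is Talagrand's notion of a stable set of functions. Let \<open>U\<close> be an ultrafilter
  on a stable set of measurable functions that converges pointwise to \<open>p\<close>, and let \<open>h\<close> be the weak
  limit along \<open>U\<close> of the indicators of \<open>{f \<ge> r}\<close>. Then \<open>p \<ge> r\<close> almost everywhere on \<open>{h > 0}\<close>: otherwise
  \<open>p \<le> s < r\<close> on a set \<open>N \<subseteq> {h > 0}\<close> of positive outer measure, with measurable hull \<open>E\<close>, and then \<open>D\<^sub>k\<close> has full
  outer measure in \<open>E\<^sup>2\<^sup>k\<close> for all \<open>k\<close>. Indeed, for even coordinates in \<open>N\<close> the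
  functions near \<open>U\<close> are eventually \<open>< r\<close> there, while the odd coordinates in \<open>{f \<ge> r}\<^sup>k\<close> meet every set of
  positive measure in \<open>{h > 0}\<^sup>k\<close>. Hence \<open>{f \<ge> r > p}\<close> has
  small measure near \<open>U\<close>, and symmetrically for \<open>{f \<le> r < p}\<close>, so that the convergence to \<open>p\<close> is also a
  convergence in measure. In particular some sequence \<open>\<phi>(a\<^sub>n, \<cdot>)\<close> converges to \<open>p\<close> almost everywhere, and
  \<open>\<psi>(q) = lim q(a\<^sub>n)\<close> is the required relation.

  Convergence \<open>\<nu>\<close>-almost everywhere follows from that on \<open>M\<close> since \<open>\<nu>\<close> and the measure of \<open>M\<close> have the same
  image on the product \<open>\<sigma>\<close>-algebra. For uniqueness, the Riesz space is uniformly dense in the continuous functions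
  (Stone-Weierstrass), so \<open>\<nu>\<close> integrates a continuous function as \<open>M\<close> does; two
  approximating sequences with the same limit on \<open>M\<close> are therefore asymptotically equal in \<open>L\<^sup>1(\<nu>)\<close>.
\<close>

section \<open>Ultrafilters and weak limits of sets\<close>

definition ultrafilter :: "'i filter \<Rightarrow> bool" where
  "ultrafilter U \<longleftrightarrow> U \<noteq> bot \<and> (\<forall>P. eventually P U \<or> eventually (\<lambda>i. \<not> P i) U)"

text \<open>Zorn's lemma on the proper filters below \<open>F\<close>, where smaller means finer. A
  property that is eventual for the infimum of a nonempty chain is already eventual for a member, so
  the infimum stays proper. A minimal proper filter decides every \<open>P\<close>: unless
  \<open>P\<close> is refuted, its restriction to \<open>P\<close> is still proper and by minimality
  changes nothing.\<close>

lemma ultrafilter_below: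
  fixes F :: "'i filter"
  assumes "F \<noteq> bot"
  shows "\<exists>U\<le>F. ultrafilter U"
proof -
  define A where "A = {G. G \<noteq> bot \<and> G \<le> F}"
  let ?P = "\<lambda>G H. H \<le> (G :: 'i filter)"
  have "\<exists>m\<in>A. \<forall>a\<in>A. ?P m a \<longrightarrow> a = m"
  proof (rule predicate_Zorn)
    show "partial_order_on A (relation_of ?P A)"
      by (rule partial_order_on_relation_ofI) auto
    fix C assume C: "C \<in> Chains (relation_of ?P A)"
    then have CA: "C \<subseteq> A" by (rule Chains_relation_of)
    have ch: "G \<le> H \<or> H \<le> G" if "G \<in> C" "H \<in> C" for G H
      using C that by (auto simp: Chains_def relation_of_def)
    show "\<exists>u\<in>A. \<forall>a\<in>C. u \<le> a"
    proof (cases "C = {}")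
      case True
      then show ?thesis using assms by (auto simp: A_def)
    next
      case False
      have "eventually P (Inf C) \<longleftrightarrow> (\<exists>b\<in>C. eventually P b)" for P
        by (rule eventually_Inf_base[OF False]) (use ch in \<open>metis inf.absorb1 inf.absorb2 order_refl\<close>)
      then have "Inf C \<noteq> bot"
        using CA by (auto simp: trivial_limit_def A_def)
      moreover have "Inf C \<le> F"
        using False CA by (auto simp: A_def intro: Inf_lower2)
      ultimately show ?thesis by (auto simp: A_def intro!: bexI[of _ "Inf C"] Inf_lower)
    qed
  qed
  then obtain U where U: "U \<noteq> bot" "U \<le> F" and max: "\<And>G. G \<noteq> bot \<Longrightarrow> G \<le> U \<Longrightarrow> G = U"
    unfolding A_def by (metis (mono_tags, lifting) mem_Collect_eq order_trans)
  have "eventually P U \<or> eventually (\<lambda>i. \<not> P i) U" for P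
  proof (rule disjCI)
    assume "\<not> eventually (\<lambda>i. \<not> P i) U"
    then have "inf U (principal {i. P i}) \<noteq> bot"
      by (auto simp: trivial_limit_def eventually_inf_principal)
    from max[OF this] have "U \<le> principal {i. P i}" by (metis inf.cobounded1 inf.cobounded2)
    then show "eventually P U" by (simp add: le_principal)
  qed
  with U show ?thesis by (auto simp: ultrafilter_def)
qed

text \<open>Compactness yields a cluster point of the image filter, and a cluster point of an
  ultrafilter is a limit: a neighbourhood that is not eventually entered is eventually
  avoided.\<close>

lemma ultrafilter_tendsto_compact:
  assumes U: "ultrafilter U" and K: "compact K" and f: "eventually (\<lambda>i. f i \<in> K) U"
  shows "\<exists>l\<in>K. (f \<longlongrightarrow> l) U"
proof -
  have "filtermap f U \<noteq> bot" using U by (simp add: ultrafilter_def filtermap_bot_iff)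
  moreover have "eventually (\<lambda>x. x \<in> K) (filtermap f U)" using f by (simp add: eventually_filtermap)
  ultimately obtain l where l: "l \<in> K" "inf (nhds l) (filtermap f U) \<noteq> bot"
    using K unfolding compact_filter by blast
  have "eventually (\<lambda>i. f i \<in> T) U" if "open T" "l \<in> T" for T
  proof (rule ccontr)
    assume "\<not> eventually (\<lambda>i. f i \<in> T) U"
    then have "eventually (\<lambda>i. f i \<notin> T) U" using U by (auto simp: ultrafilter_def)
    then have "eventually (\<lambda>x. x \<notin> T) (filtermap f U)" by (simp add: eventually_filtermap)
    moreover have "eventually (\<lambda>x. x \<in> T) (nhds l)" using that by (auto simp: eventually_nhds)
    ultimately have "eventually (\<lambda>x. False) (inf (nhds l) (filtermap f U))"
      unfolding eventually_inf by blast
    with l(2) show False by (simp add: trivial_limit_def)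
  qed
  with l(1) show ?thesis by (auto intro: topological_tendstoI)
qed

text \<open>The setwise limits exist because the values stay in a compact interval, and finite
  additivity survives the limit. Countable additivity holds because the limit is dominated by
  \<open>M\<close> and is therefore continuous at the empty set. The same domination gives absolute
  continuity.\<close>

lemma ultralimit_measure:
  fixes M :: "'a measure"
  assumes "finite_measure M" and U: "ultrafilter U" and S: "eventually (\<lambda>i. S i \<in> sets M) U"
  shows "\<exists>N. sets N = sets M \<and> finite_measure N \<and> absolutely_continuous M N \<and>
    (\<forall>V\<in>sets M. ((\<lambda>i. measure M (V \<inter> S i)) \<longlongrightarrow> measure N V) U)"
proof -
  interpret finite_measure M by fact
  have Ub: "U \<noteq> bot" using U by (simp add: ultrafilter_def)
  have "\<exists>l\<in>{0..measure M V}. ((\<lambda>i. measure M (V \<inter> S i)) \<longlongrightarrow> l) U" if "V \<in> sets M" for V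
    by (rule ultrafilter_tendsto_compact[OF U]) (use that S in \<open>auto intro!: always_eventually finite_measure_mono\<close>)
  then obtain m where m: "\<And>V. V \<in> sets M \<Longrightarrow> 0 \<le> m V \<and> m V \<le> measure M V"
    and lim: "\<And>V. V \<in> sets M \<Longrightarrow> ((\<lambda>i. measure M (V \<inter> S i)) \<longlongrightarrow> m V) U"
    by (metis atLeastAtMost_iff)
  have m_add: "m (A \<union> B) = m A + m B" if AB: "A \<in> sets M" "B \<in> sets M" "A \<inter> B = {}" for A B
  proof (rule tendsto_unique[OF Ub lim])
    show "A \<union> B \<in> sets M" using AB by auto
    have "((\<lambda>i. measure M (A \<inter> S i) + measure M (B \<inter> S i)) \<longlongrightarrow> m A + m B) U"
      using AB by (intro tendsto_add lim)
    moreover have "eventually (\<lambda>i. measure M (A \<inter> S i) + measure M (B \<inter> S i) = measure M ((A \<union> B) \<inter> S i)) U"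
      using S
    proof eventually_elim
      case (elim i)
      then show ?case using AB
        by (subst finite_measure_Union[symmetric]) (auto simp: Int_Un_distrib2)
    qed
    ultimately show "((\<lambda>i. measure M ((A \<union> B) \<inter> S i)) \<longlongrightarrow> m A + m B) U"
      by (rule Lim_transform_eventually)
  qed
  have "countably_additive (sets M) (\<lambda>V. ennreal (m V))"
  proof (rule sets.empty_continuous_imp_countably_additive)
    show "positive (sets M) (\<lambda>V. ennreal (m V))" using m[of "{}"] by (simp add: positive_def)
    show "additive (sets M) (\<lambda>V. ennreal (m V))"
      unfolding additive_def using m by (simp add: m_add)
    fix A :: "nat \<Rightarrow> 'a set" assume A: "range A \<subseteq> sets M" "decseq A" "(\<Inter>i. A i) = {}"
    have Ai: "A i \<in> sets M" for i using A(1) by blast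
    have "(\<lambda>i. measure M (A i)) \<longlonglongrightarrow> 0"
      using finite_Lim_measure_decseq[OF A(1,2)] A(3) by simp
    then have "(\<lambda>i. m (A i)) \<longlonglongrightarrow> 0"
      by (rule tendsto_sandwich[where f = "\<lambda>_. 0", rotated 3]) (simp_all add: m Ai)
    from tendsto_ennrealI[OF this] show "(\<lambda>i. ennreal (m (A i))) \<longlonglongrightarrow> 0" by simp
  qed auto
  moreover have "positive (sets M) (\<lambda>V. ennreal (m V))" using m[of "{}"] by (simp add: positive_def)
  moreover define N where "N = measure_of (space M) (sets M) (\<lambda>V. ennreal (m V))"
  ultimately have N: "emeasure N V = ennreal (m V)" if "V \<in> sets M" for V
    using that by (simp add: emeasure_measure_of_sigma sets.sigma_algebra_axioms)
  have sN [simp]: "sets N = sets M" "space N = space M" by (simp_all add: N_def)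
  have mN: "measure N V = m V" if "V \<in> sets M" for V
    using N[OF that] m[OF that] by (simp add: measure_def)
  show ?thesis
  proof (intro exI conjI ballI)
    show "finite_measure N" by (rule finite_measureI) (simp add: N)
    show "absolutely_continuous M N"
      unfolding absolutely_continuous_def
    proof (intro subsetI null_setsI)
      fix V assume V: "V \<in> null_sets M"
      then have "measure M V = 0" by (simp add: null_setsD1 measure_def)
      with V m[of V] show "emeasure N V = 0" by (simp add: N null_setsD2)
    qed auto
  qed (use lim mN in auto)
qed

text \<open>\<open>H\<close> is the set where the weak limit of the indicators of \<open>S i\<close> is nonzero.\<close>
lemma ultralimit_support:
  fixes M :: "'a measure"
  assumes "prob_space M" and U: "ultrafilter U" and S: "eventually (\<lambda>i. S i \<in> sets M) U"
  shows "\<exists>H\<in>sets M. ((\<lambda>i. measure M (S i - H)) \<longlongrightarrow> 0) U \<and>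
    (\<forall>(J :: 'j set) V. finite J \<and> V \<in> sets (Pi\<^sub>M J (\<lambda>_. M)) \<and>
        eventually (\<lambda>i. V \<inter> Pi\<^sub>E J (\<lambda>_. S i) = {}) U \<longrightarrow>
        V \<inter> Pi\<^sub>E J (\<lambda>_. H) \<in> null_sets (Pi\<^sub>M J (\<lambda>_. M)))"
proof -
  interpret prob_space M by fact
  interpret pp: product_prob_space "\<lambda>_ :: 'j. M" UNIV by standard
  have Ub: "U \<noteq> bot" using U by (simp add: ultrafilter_def)
  obtain N where N: "sets N = sets M" "finite_measure N" "absolutely_continuous M N"
    and N_lim: "\<And>V. V \<in> sets M \<Longrightarrow> ((\<lambda>i. measure M (V \<inter> S i)) \<longlongrightarrow> measure N V) U"
    using ultralimit_measure[OF _ U S] finite_measure_axioms by blast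
  interpret N: finite_measure N by fact
  obtain h where h [measurable]: "h \<in> borel_measurable M" and hN: "density M h = N"
    using Radon_Nikodym[OF N(3,1)] by blast
  define H where "H = {a \<in> space M. h a \<noteq> 0}"
  have [measurable]: "H \<in> sets M" unfolding H_def by measurable
  have "measure N (space M - H) = 0"
  proof -
    have "emeasure N (space M - H) = (\<integral>\<^sup>+a. h a * indicator (space M - H) a \<partial>M)"
      unfolding hN[symmetric] by (rule emeasure_density) auto
    also have "\<dots> = (\<integral>\<^sup>+a. 0 \<partial>M)" by (rule nn_integral_cong) (auto simp: H_def indicator_def)
    finally show ?thesis by (simp add: measure_def)
  qed
  then have "((\<lambda>i. measure M ((space M - H) \<inter> S i)) \<longlongrightarrow> 0) U"
    using N_lim[of "space M - H"] by simp
  then have lim0: "((\<lambda>i. measure M (S i - H)) \<longlongrightarrow> 0) U"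
    by (rule Lim_transform_eventually)
      (use S in eventually_elim, metis Int_Diff Int_commute sets.Int_space_eq2)
  \<comment> \<open>The boxes over the sets \<open>S i\<close> have a weak limit too, namely the
    measure \<open>Q\<close> with density \<open>\<Prod>j\<in>J. h (v j)\<close>. A set that
    eventually misses these boxes is null for \<open>Q\<close>, and the density does not vanish on
    the box over \<open>H\<close>.\<close>
  have null: "V \<inter> Pi\<^sub>E J (\<lambda>_. H) \<in> null_sets (Pi\<^sub>M J (\<lambda>_. M))"
    if J: "finite J" and V: "V \<in> sets (Pi\<^sub>M J (\<lambda>_. M))"
      and e: "eventually (\<lambda>i. V \<inter> Pi\<^sub>E J (\<lambda>_. S i) = {}) U" for J :: "'j set" and V
  proof -
    let ?P = "Pi\<^sub>M J (\<lambda>_. M)"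
    interpret P: prob_space ?P by (rule prob_space_PiM) (rule prob_space_axioms)
    have S': "eventually (\<lambda>i. Pi\<^sub>E J (\<lambda>_. S i) \<in> sets ?P) U"
      using S by eventually_elim (use J in \<open>auto intro: sets_PiM_I_finite\<close>)
    obtain Q where Q: "sets Q = sets ?P" "finite_measure Q"
      and Q_lim: "\<And>V. V \<in> sets ?P \<Longrightarrow> ((\<lambda>i. measure ?P (V \<inter> Pi\<^sub>E J (\<lambda>_. S i))) \<longlongrightarrow> measure Q V) U"
      using ultralimit_measure[OF P.finite_measure_axioms U S'] by blast
    interpret Q: finite_measure Q by fact
    interpret NN: product_sigma_finite "\<lambda>_ :: 'j. N" by standard
    have sPN: "sets (Pi\<^sub>M J (\<lambda>_. N)) = sets ?P" using N(1) by (intro sets_PiM_cong) auto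
    \<comment> \<open>The coordinates are independent, so the measure of a box factors before the
      limit and hence after it. Boxes determine the measure, which identifies \<open>Q\<close> with
      the power of \<open>N\<close>.\<close>
    have rect: "emeasure Q (Pi\<^sub>E J A) = (\<Prod>j\<in>J. emeasure N (A j))"
      if A: "\<And>j. j \<in> J \<Longrightarrow> A j \<in> sets N" for A
    proof -
      have A': "\<And>j. j \<in> J \<Longrightarrow> A j \<in> sets M" using A N(1) by simp
      have "((\<lambda>i. \<Prod>j\<in>J. measure M (A j \<inter> S i)) \<longlongrightarrow> (\<Prod>j\<in>J. measure N (A j))) U"
        by (intro tendsto_prod N_lim A')
      moreover have "eventually (\<lambda>i. (\<Prod>j\<in>J. measure M (A j \<inter> S i)) =
          measure ?P (Pi\<^sub>E J A \<inter> Pi\<^sub>E J (\<lambda>_. S i))) U"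
        using S
      proof eventually_elim
        case (elim i)
        have "emeasure ?P (Pi\<^sub>E J A \<inter> Pi\<^sub>E J (\<lambda>_. S i)) = (\<Prod>j\<in>J. emeasure M (A j \<inter> S i))"
          unfolding PiE_Int by (rule pp.emeasure_PiM[OF J]) (use A' elim in auto)
        also have "\<dots> = ennreal (\<Prod>j\<in>J. measure M (A j \<inter> S i))"
          by (simp add: emeasure_eq_measure prod_ennreal)
        finally show ?case
          by (simp add: measure_def prod_nonneg)
      qed
      ultimately have "((\<lambda>i. measure ?P (Pi\<^sub>E J A \<inter> Pi\<^sub>E J (\<lambda>_. S i))) \<longlongrightarrow> (\<Prod>j\<in>J. measure N (A j))) U"
        by (rule Lim_transform_eventually)
      moreover have "((\<lambda>i. measure ?P (Pi\<^sub>E J A \<inter> Pi\<^sub>E J (\<lambda>_. S i))) \<longlongrightarrow> measure Q (Pi\<^sub>E J A)) U"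
        by (rule Q_lim) (use A' J in \<open>auto intro: sets_PiM_I_finite\<close>)
      ultimately have "measure Q (Pi\<^sub>E J A) = (\<Prod>j\<in>J. measure N (A j))"
        using tendsto_unique[OF Ub] by blast
      then show ?thesis
        by (simp add: Q.emeasure_eq_measure N.emeasure_eq_measure prod_ennreal)
    qed
    have "Q = Pi\<^sub>M J (\<lambda>_. N)"
      by (rule NN.PiM_eqI[OF J]) (use Q(1) sPN rect in auto)
    moreover have "density ?P (\<lambda>v. \<Prod>j\<in>J. h (v j)) = Pi\<^sub>M J (\<lambda>_. N)"
    proof (rule NN.PiM_eqI[OF J])
      show "sets (density ?P (\<lambda>v. \<Prod>j\<in>J. h (v j))) = sets (Pi\<^sub>M J (\<lambda>_. N))" using sPN by simp
      fix A assume A: "\<And>j. j \<in> J \<Longrightarrow> A j \<in> sets N"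
      then have A' [measurable]: "\<And>j. j \<in> J \<Longrightarrow> A j \<in> sets M" using N(1) by simp
      have "emeasure (density ?P (\<lambda>v. \<Prod>j\<in>J. h (v j))) (Pi\<^sub>E J A)
          = (\<integral>\<^sup>+v. (\<Prod>j\<in>J. h (v j)) * indicator (Pi\<^sub>E J A) v \<partial>?P)"
        by (rule emeasure_density) (use J A' in \<open>auto intro!: sets_PiM_I_finite borel_measurable_prod_ennreal\<close>)
      also have "\<dots> = (\<integral>\<^sup>+v. (\<Prod>j\<in>J. h (v j) * indicator (A j) (v j)) \<partial>?P)"
      proof (rule nn_integral_cong)
        fix v assume "v \<in> space ?P"
        then have "v \<in> Pi\<^sub>E J A \<longleftrightarrow> (\<forall>j\<in>J. v j \<in> A j)" by (auto simp: space_PiM PiE_iff)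
        then have "indicator (Pi\<^sub>E J A) v = (\<Prod>j\<in>J. indicator (A j) (v j) :: ennreal)"
          using J by (cases "v \<in> Pi\<^sub>E J A") (auto simp: indicator_def)
        then show "(\<Prod>j\<in>J. h (v j)) * indicator (Pi\<^sub>E J A) v = (\<Prod>j\<in>J. h (v j) * indicator (A j) (v j))"
          by (simp add: prod.distrib)
      qed
      also have "\<dots> = (\<Prod>j\<in>J. \<integral>\<^sup>+a. h a * indicator (A j) a \<partial>M)"
        by (rule pp.product_nn_integral_prod[OF J]) measurable
      also have "\<dots> = (\<Prod>j\<in>J. emeasure N (A j))"
        unfolding hN[symmetric] by (intro prod.cong refl emeasure_density[symmetric]) auto
      finally show "emeasure (density ?P (\<lambda>v. \<Prod>j\<in>J. h (v j))) (Pi\<^sub>E J A) = (\<Prod>j\<in>J. emeasure N (A j))" .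
    qed
    moreover have "measure Q V = 0"
      by (rule tendsto_unique[OF Ub Q_lim[OF V]], rule tendsto_eventually)
        (use e in \<open>eventually_elim, simp\<close>)
    then have "emeasure Q V = 0" by (simp add: Q.emeasure_eq_measure)
    ultimately have "emeasure (density ?P (\<lambda>v. \<Prod>j\<in>J. h (v j))) V = 0"
      by simp
    then have "V \<in> null_sets (density ?P (\<lambda>v. \<Prod>j\<in>J. h (v j)))" using V by auto
    then have "AE v in ?P. v \<in> V \<longrightarrow> (\<Prod>j\<in>J. h (v j)) = 0"
      by (subst (asm) null_sets_density_iff) (use J in \<open>auto intro!: borel_measurable_prod_ennreal\<close>)
    then have "AE v in ?P. v \<notin> V \<inter> Pi\<^sub>E J (\<lambda>_. H)"
      by eventually_elim (use J in \<open>auto simp: H_def PiE_iff\<close>)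
    then show ?thesis
      by (subst AE_iff_null_sets) (use J V in \<open>auto intro!: sets_PiM_I_finite\<close>)
  qed
  show ?thesis
    by (rule bexI[of _ H]) (use lim0 null in auto)
qed

section \<open>Stable sets of functions\<close>

text \<open>The assumption \<open>hull\<close> says that \<open>N\<close> has full outer measure in \<open>E\<close>.\<close>
lemma full_outer_measure_PiE:
  assumes "prob_space M" and E: "E \<in> sets M" and NE: "N \<subseteq> E"
    and hull: "\<And>Z. Z \<in> sets M \<Longrightarrow> N \<subseteq> Z \<Longrightarrow> E - Z \<in> null_sets M"
    and "finite I" and "Z \<in> sets (Pi\<^sub>M I (\<lambda>_. M))" and "Pi\<^sub>E I (\<lambda>_. N) \<subseteq> Z"
  shows "Pi\<^sub>E I (\<lambda>_. E) - Z \<in> null_sets (Pi\<^sub>M I (\<lambda>_. M))"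
  using assms(5-7)
proof (induction I arbitrary: Z rule: finite_induct)
  case empty
  then show ?case by auto
next
  case (insert i I)
  interpret prob_space M by fact
  interpret product_prob_space "\<lambda>_. M" UNIV by standard
  let ?P = "\<lambda>I. Pi\<^sub>M I (\<lambda>_. M)"
  define W where "W = Pi\<^sub>E (insert i I) (\<lambda>_. E) - Z"
  have W [measurable]: "W \<in> sets (?P (insert i I))"
    unfolding W_def using insert E by (auto intro!: sets_PiM_I_finite sets.Diff)
  \<comment> \<open>Fubini in the new coordinate: \<open>g y\<close> is the measure of the section
    at \<open>y\<close> of the exceptional set. The induction hypothesis makes it 0 for
    \<open>y\<close> in \<open>N\<close>; its zero set is measurable, so \<open>hull\<close> extends
    this to almost all of \<open>E\<close>, and off \<open>E\<close> the section is empty.\<close>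
  define g where "g y = (\<integral>\<^sup>+x. indicator W (x(i := y)) \<partial>?P I)" for y
  have upd [measurable]: "(\<lambda>x. x(i := y)) \<in> ?P I \<rightarrow>\<^sub>M ?P (insert i I)" if "y \<in> space M" for y
    using that by measurable
  have [measurable]: "g \<in> borel_measurable M"
  proof -
    interpret PI: sigma_finite_measure "?P I" by (intro prob_space_imp_sigma_finite prob_space_PiM \<open>prob_space M\<close>)
    show ?thesis unfolding g_def by measurable
  qed
  define Z' where "Z' = {y \<in> space M. g y = 0}"
  have Z': "Z' \<in> sets M" unfolding Z'_def by measurable
  have "N \<subseteq> Z'"
  proof
    fix y assume y: "y \<in> N"
    have yM: "y \<in> space M" using y NE sets.sets_into_space[OF E] by blast
    define Y where "Y = (\<lambda>x. x(i := y)) -` Z \<inter> space (?P I)"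
    have Y: "Y \<in> sets (?P I)" unfolding Y_def by (rule measurable_sets[OF upd[OF yM] insert(4)])
    have "Pi\<^sub>E I (\<lambda>_. N) \<subseteq> Y"
    proof
      fix x assume x: "x \<in> Pi\<^sub>E I (\<lambda>_. N)"
      then have "x(i := y) \<in> Pi\<^sub>E (insert i I) (\<lambda>_. N)" using y by (auto simp: PiE_iff extensional_def)
      moreover have "x \<in> space (?P I)"
        using x NE sets.sets_into_space[OF E] by (auto simp: space_PiM PiE_iff)
      ultimately show "x \<in> Y" using insert(5) by (auto simp: Y_def)
    qed
    then have "Pi\<^sub>E I (\<lambda>_. E) - Y \<in> null_sets (?P I)" by (rule insert.IH[OF Y])
    then have "AE x in ?P I. x \<notin> Pi\<^sub>E I (\<lambda>_. E) - Y" by (rule AE_not_in)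
    then have "AE x in ?P I. indicator W (x(i := y)) = (0 :: ennreal)"
    proof (rule AE_mp, intro AE_I2 impI)
      fix x assume x: "x \<in> space (?P I)" "x \<notin> Pi\<^sub>E I (\<lambda>_. E) - Y"
      have "x \<in> Pi\<^sub>E I (\<lambda>_. E)" if "x(i := y) \<in> Pi\<^sub>E (insert i I) (\<lambda>_. E)"
        using that x(1) insert(2) by (auto simp: space_PiM PiE_iff split: if_splits)
      with x show "indicator W (x(i := y)) = (0 :: ennreal)"
        by (auto simp: indicator_def W_def Y_def)
    qed
    then have "g y = 0" unfolding g_def
      by (subst nn_integral_0_iff_AE) (use yM in auto)
    with yM show "y \<in> Z'" by (simp add: Z'_def)
  qed
  then have "E - Z' \<in> null_sets M" by (rule hull[OF Z'])
  then have "AE y in M. y \<notin> E - Z'" by (rule AE_not_in)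
  then have "AE y in M. g y = 0"
  proof eventually_elim
    case (elim y)
    show ?case
    proof (cases "y \<in> E")
      case True
      then show ?thesis using elim by (simp add: Z'_def)
    next
      case False
      then show ?thesis by (auto simp: g_def W_def PiE_iff indicator_def)
    qed
  qed
  then have "emeasure (?P (insert i I)) W = 0"
    using product_nn_integral_insert_rev[OF insert(1,2), of "indicator W"]
    by (simp add: g_def[symmetric] nn_integral_0_iff_AE)
  with W show ?case by (auto simp: W_def[symmetric])
qed

text \<open>A measurable cover attaining the outer measure of \<open>N\<close> is cut down to
  \<open>H\<close>. Any measurable \<open>Z\<close> containing \<open>N\<close> must meet it in a
  set of at least that measure, so only a null set is left over.\<close>

lemma measurable_hull:
  assumes "finite_measure M" and H: "H \<in> sets M" and N: "N \<subseteq> H"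
  shows "\<exists>E\<in>sets M. N \<subseteq> E \<and> E \<subseteq> H \<and> (\<forall>Z\<in>sets M. N \<subseteq> Z \<longrightarrow> E - Z \<in> null_sets M)"
proof -
  interpret finite_measure M by fact
  have "N \<subseteq> space M" using N sets.sets_into_space[OF H] by blast
  then obtain E0 where E0: "E0 \<in> sets M" "N \<subseteq> E0" "outer_measure_of M N = emeasure M E0"
    using outer_measure_of_attain by metis
  have "(E0 \<inter> H) - Z \<in> null_sets M" if Z: "Z \<in> sets M" "N \<subseteq> Z" for Z
  proof -
    have "emeasure M E0 \<le> emeasure M (E0 \<inter> H \<inter> Z)"
      unfolding E0(3)[symmetric] outer_measure_of_def
      by (rule INF_lower) (use E0 H Z N in auto)
    moreover have "emeasure M E0 \<ge> emeasure M (E0 \<inter> H)" using E0(1) by (intro emeasure_mono) auto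
    ultimately have "measure M (E0 \<inter> H) \<le> measure M (E0 \<inter> H \<inter> Z)"
      by (simp add: emeasure_eq_measure)
    then have "measure M ((E0 \<inter> H) - Z) \<le> 0"
      using E0 H Z by (subst finite_measure_Diff') auto
    then have "measure M ((E0 \<inter> H) - Z) = 0" using measure_nonneg[of M] by (metis order_antisym)
    then show ?thesis using E0 H Z by (auto simp: emeasure_eq_measure)
  qed
  then show ?thesis using E0 H N by (intro bexI[of _ "E0 \<inter> H"]) auto
qed

text \<open>Fubini with the coordinates in \<open>I\<close> outside. For a fixed \<open>u\<close>
  with values in \<open>N\<close>, the exceptional section \<open>X u\<close> eventually misses the
  boxes over \<open>S i\<close>, and it lies over \<open>E \<subseteq> H\<close>, so it is null by
  \<open>null\<close>. The \<open>u\<close> with null section form a measurable set, and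
  \<open>N\<close> has full outer measure in \<open>E\<close>, so almost every \<open>u\<close> with
  values in \<open>E\<close> is of this kind. The index \<open>i\<close> is chosen after
  \<open>u\<close>, which is why \<open>ev\<close> is demanded for each \<open>u\<close>
  separately.\<close>

lemma product_full_measure:
  fixes S :: "'i \<Rightarrow> 'a set"
  assumes "prob_space M" and E: "E \<in> sets M" and EH: "E \<subseteq> H" and NE: "N \<subseteq> E"
    and hull: "\<And>Z. Z \<in> sets M \<Longrightarrow> N \<subseteq> Z \<Longrightarrow> E - Z \<in> null_sets M"
    and fin: "finite I" "finite J" "I \<inter> J = {}" and W: "W \<in> sets (Pi\<^sub>M (I \<union> J) (\<lambda>_. M))"
    and null: "\<And>V. V \<in> sets (Pi\<^sub>M J (\<lambda>_. M)) \<Longrightarrow>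
        eventually (\<lambda>i. V \<inter> Pi\<^sub>E J (\<lambda>_. S i) = {}) U \<Longrightarrow>
        V \<inter> Pi\<^sub>E J (\<lambda>_. H) \<in> null_sets (Pi\<^sub>M J (\<lambda>_. M))"
    and ev: "\<And>u. u \<in> Pi\<^sub>E I (\<lambda>_. N) \<Longrightarrow>
        eventually (\<lambda>i. \<forall>v\<in>Pi\<^sub>E J (\<lambda>_. S i \<inter> E). merge I J (u, v) \<in> W) U"
  shows "Pi\<^sub>E (I \<union> J) (\<lambda>_. E) - W \<in> null_sets (Pi\<^sub>M (I \<union> J) (\<lambda>_. M))"
proof -
  interpret prob_space M by fact
  interpret product_prob_space "\<lambda>_. M" UNIV by standard
  let ?P = "\<lambda>I. Pi\<^sub>M I (\<lambda>_. M)"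
  define V where "V = Pi\<^sub>E (I \<union> J) (\<lambda>_. E) - W"
  have V: "V \<in> sets (?P (I \<union> J))"
    unfolding V_def using fin E W by (auto intro!: sets_PiM_I_finite sets.Diff)
  define X where "X u = (\<lambda>v. merge I J (u, v)) -` V \<inter> space (?P J)" for u
  have XE: "X u \<subseteq> Pi\<^sub>E J (\<lambda>_. E)" for u
  proof
    fix v assume "v \<in> X u"
    then have v: "v \<in> space (?P J)" "merge I J (u, v) \<in> Pi\<^sub>E (I \<union> J) (\<lambda>_. E)"
      by (auto simp: X_def V_def)
    have "v j \<in> E" if "j \<in> J" for j
      using PiE_mem[OF v(2), of j] that fin(3) by (auto simp: merge_def split: if_splits)
    then show "v \<in> Pi\<^sub>E J (\<lambda>_. E)" using v(1) by (auto simp: space_PiM PiE_iff)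
  qed
  define k where "k u = emeasure (?P J) (X u)" for u
  have [measurable]: "k \<in> borel_measurable (?P I)"
    unfolding k_def X_def by (rule emeasure_fold_measurable[OF fin(3,1,2) V])
  define Z where "Z = {u \<in> space (?P I). k u = 0}"
  have Z: "Z \<in> sets (?P I)" unfolding Z_def by measurable
  have "Pi\<^sub>E I (\<lambda>_. N) \<subseteq> Z"
  proof
    fix u assume u: "u \<in> Pi\<^sub>E I (\<lambda>_. N)"
    have uS: "u \<in> space (?P I)"
      using u NE sets.sets_into_space[OF E] by (auto simp: space_PiM PiE_iff)
    have X: "X u \<in> sets (?P J)"
      unfolding X_def
      by (rule measurable_sets[OF measurable_compose[OF measurable_Pair1'[OF uS] measurable_merge] V])
    have "eventually (\<lambda>i. X u \<inter> Pi\<^sub>E J (\<lambda>_. S i) = {}) U"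
      using ev[OF u]
    proof eventually_elim
      case (elim i)
      have False if v: "v \<in> X u" "v \<in> Pi\<^sub>E J (\<lambda>_. S i)" for v
      proof -
        have "v \<in> Pi\<^sub>E J (\<lambda>_. S i \<inter> E)" using v XE[of u] by (auto simp: PiE_iff subset_iff)
        with elim have "merge I J (u, v) \<in> W" by blast
        with v(1) show False by (auto simp: X_def V_def)
      qed
      then show ?case by blast
    qed
    from null[OF X this] have "X u \<inter> Pi\<^sub>E J (\<lambda>_. H) \<in> null_sets (?P J)" .
    moreover have "X u \<inter> Pi\<^sub>E J (\<lambda>_. H) = X u" using XE[of u] PiE_mono[of J "\<lambda>_. E" "\<lambda>_. H"] EH by blast
    ultimately show "u \<in> Z" using uS by (auto simp: Z_def k_def)
  qed
  then have "Pi\<^sub>E I (\<lambda>_. E) - Z \<in> null_sets (?P I)"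
    by (rule full_outer_measure_PiE[OF \<open>prob_space M\<close> E NE hull fin(1) Z, rotated 2])
  then have "AE u in ?P I. u \<notin> Pi\<^sub>E I (\<lambda>_. E) - Z" by (rule AE_not_in)
  then have "AE u in ?P I. k u = 0"
  proof (rule AE_mp, intro AE_I2 impI)
    fix u assume uS: "u \<in> space (?P I)" and u: "u \<notin> Pi\<^sub>E I (\<lambda>_. E) - Z"
    show "k u = 0"
    proof (cases "u \<in> Pi\<^sub>E I (\<lambda>_. E)")
      case True
      then show ?thesis using u by (simp add: Z_def)
    next
      case False
      then obtain j where j: "j \<in> I" "u j \<notin> E" using uS by (auto simp: space_PiM PiE_iff)
      have "merge I J (u, v) \<notin> V" for v
      proof
        assume "merge I J (u, v) \<in> V"
        then have "merge I J (u, v) j \<in> E" using j(1) by (auto simp: V_def PiE_iff)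
        with j show False by (simp add: merge_def)
      qed
      then have "X u = {}" by (auto simp: X_def)
      then show ?thesis by (simp add: k_def)
    qed
  qed
  then have "emeasure (?P (I \<union> J)) V = 0"
    unfolding emeasure_fold_integral[OF fin(3,1,2) V] X_def[symmetric] k_def[symmetric]
    by (simp add: nn_integral_0_iff_AE)
  with V show ?thesis by (auto simp: V_def)
qed

section \<open>Talagrand stability and level cuts\<close>

text \<open>The condition of \<open>almost_dependent\<close> for an arbitrary set of functions. It
  passes to subsets because \<open>D\<close> is monotone in \<open>A\<close>.\<close>

definition talagrand_stable :: "'a measure \<Rightarrow> ('a \<Rightarrow> real) set \<Rightarrow> bool" where
  "talagrand_stable M A \<longleftrightarrow> (\<forall>E\<in>sets M. \<forall>s r. emeasure M E > 0 \<and> s < r \<longrightarrow>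
     (\<exists>k\<ge>1. outer_measure_of (Pi\<^sub>M {..<2 * k} (\<lambda>_. M)) (D k A E s r) < emeasure M E ^ (2 * k)))"

text \<open>
  The flag \<open>c\<close> decides whether the coordinates ranging over \<open>N\<close> are the even ones (where \<open>p\<close> is small) or the
  odd ones (where \<open>p\<close> is large).
\<close>
lemma stable_null:
  fixes U :: "'i filter" and c :: bool
  assumes "prob_space M" and stab: "talagrand_stable M A" and sr: "s < r" and H: "H \<in> sets M" and NH: "N \<subseteq> H"
    and null: "\<And>(J :: nat set) V. finite J \<Longrightarrow> V \<in> sets (Pi\<^sub>M J (\<lambda>_. M)) \<Longrightarrow>
        eventually (\<lambda>i. V \<inter> Pi\<^sub>E J (\<lambda>_. S i) = {}) U \<Longrightarrow>
        V \<inter> Pi\<^sub>E J (\<lambda>_. H) \<in> null_sets (Pi\<^sub>M J (\<lambda>_. M))"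
    and ev: "\<And>F. finite F \<Longrightarrow> F \<subseteq> N \<Longrightarrow> eventually (\<lambda>i. f i \<in> A \<and>
        (\<forall>b\<in>F. if c then f i b \<le> s else r \<le> f i b) \<and>
        (\<forall>b\<in>S i. if c then r \<le> f i b else f i b \<le> s)) U"
  shows "\<exists>Z\<in>null_sets M. N \<subseteq> Z"
proof -
  interpret prob_space M by fact
  obtain E where E: "E \<in> sets M" "N \<subseteq> E" "E \<subseteq> H"
    and hull: "\<And>Z. Z \<in> sets M \<Longrightarrow> N \<subseteq> Z \<Longrightarrow> E - Z \<in> null_sets M"
    using measurable_hull[OF finite_measure_axioms H NH] by blast
  have "emeasure M E = 0"
  proof (rule ccontr)
    assume "emeasure M E \<noteq> 0"
    then have "emeasure M E > 0" by (simp add: zero_less_iff_neq_zero)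
    then obtain k where k: "outer_measure_of (Pi\<^sub>M {..<2 * k} (\<lambda>_. M)) (D k A E s r) < emeasure M E ^ (2 * k)"
      using stab E(1) sr unfolding talagrand_stable_def by blast
    let ?P = "Pi\<^sub>M {..<2 * k} (\<lambda>_. M)"
    interpret product_prob_space "\<lambda>_ :: nat. M" UNIV by standard
    have "D k A E s r \<subseteq> space ?P"
      using sets.sets_into_space[OF E(1)] by (fastforce simp: D_def space_PiM PiE_iff)
    \<comment> \<open>\<open>D k A E s r\<close> is a union over all of \<open>A\<close> and may
      fail to be measurable, hence the cover \<open>W\<close> of the same outer measure. If
      \<open>W\<close> fills the power of \<open>E\<close> up to a null set, its measure contradicts
      the choice of \<open>k\<close>.\<close>
    then obtain W where W: "W \<in> sets ?P" "D k A E s r \<subseteq> W"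
      "outer_measure_of ?P (D k A E s r) = emeasure ?P W"
      using outer_measure_of_attain by metis
    define I where "I = {j. j < 2 * k \<and> even j = c}"
    define J where "J = {j. j < 2 * k \<and> even j \<noteq> c}"
    have IJ: "finite I" "finite J" "I \<inter> J = {}" "I \<union> J = {..<2 * k}" by (auto simp: I_def J_def)
    have "Pi\<^sub>E (I \<union> J) (\<lambda>_. E) - W \<in> null_sets (Pi\<^sub>M (I \<union> J) (\<lambda>_. M))"
    proof (rule product_full_measure[OF \<open>prob_space M\<close> E(1,3,2) hull IJ(1-3)])
      show "W \<in> sets (Pi\<^sub>M (I \<union> J) (\<lambda>_. M))" using W(1) IJ(4) by simp
      show "V \<inter> Pi\<^sub>E J (\<lambda>_. H) \<in> null_sets (Pi\<^sub>M J (\<lambda>_. M))"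
        if "V \<in> sets (Pi\<^sub>M J (\<lambda>_. M))" "eventually (\<lambda>i. V \<inter> Pi\<^sub>E J (\<lambda>_. S i) = {}) U" for V
        by (rule null[OF IJ(2) that])
      fix u assume u: "u \<in> Pi\<^sub>E I (\<lambda>_. N)"
      then have "u ` I \<subseteq> N" by auto
      \<comment> \<open>A tuple \<open>u\<close> involves only finitely many points of
        \<open>N\<close>, so eventually \<open>f i\<close> is on the required side at all of them.
        With \<open>v\<close> taken from \<open>S i\<close>, the same function \<open>f i\<close>
        witnesses that the merged tuple lies in \<open>D\<close>.\<close>
      from ev[OF finite_imageI[OF IJ(1)] this]
      show "eventually (\<lambda>i. \<forall>v\<in>Pi\<^sub>E J (\<lambda>_. S i \<inter> E). merge I J (u, v) \<in> W) U"
      proof (eventually_elim, intro ballI)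
        fix i v
        assume i: "f i \<in> A \<and> (\<forall>b\<in>u ` I. if c then f i b \<le> s else r \<le> f i b) \<and>
          (\<forall>b\<in>S i. if c then r \<le> f i b else f i b \<le> s)"
          and v: "v \<in> Pi\<^sub>E J (\<lambda>_. S i \<inter> E)"
        let ?w = "merge I J (u, v)"
        have wI: "?w j = u j" if "j \<in> I" for j using that by (simp add: merge_def)
        have wJ: "?w j = v j" if "j \<in> J" for j using that IJ(3) by (auto simp: merge_def)
        have "?w \<in> Pi\<^sub>E (I \<union> J) (\<lambda>_. E)"
          unfolding PiE_iff
        proof (intro conjI ballI)
          fix j assume "j \<in> I \<union> J"
          then show "?w j \<in> E" using u v E(2) by (cases "j \<in> I") (auto simp: wI wJ PiE_iff)
        qed auto
        moreover have "f i (?w (2 * j)) \<le> s \<and> r \<le> f i (?w (2 * j + 1))" if j: "j < k" for j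
        proof (cases c)
          case True
          then have "2 * j \<in> I" "2 * j + 1 \<in> J" using j by (auto simp: I_def J_def)
          then show ?thesis using i v True by (auto simp: wI wJ PiE_iff)
        next
          case False
          then have "2 * j \<in> J" "2 * j + 1 \<in> I" using j by (auto simp: I_def J_def)
          then show ?thesis using i v False by (auto simp: wI wJ PiE_iff)
        qed
        ultimately have "?w \<in> D k A E s r" using i by (auto simp: D_def IJ(4))
        with W(2) show "?w \<in> W" by blast
      qed
    qed
    then have null': "Pi\<^sub>E {..<2 * k} (\<lambda>_. E) - W \<in> null_sets ?P" by (simp only: IJ(4))
    have "emeasure M E ^ (2 * k) = emeasure ?P (Pi\<^sub>E {..<2 * k} (\<lambda>_. E))"
      using E(1) by (subst emeasure_PiM) auto
    also have "\<dots> \<le> emeasure ?P (W \<union> (Pi\<^sub>E {..<2 * k} (\<lambda>_. E) - W))"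
      using W(1) null_setsD2[OF null'] by (intro emeasure_mono sets.Un) auto
    also have "\<dots> = emeasure ?P W" by (rule emeasure_Un_null_set[OF W(1) null'])
    finally show False using k W(3) by simp
  qed
  then show ?thesis using E by (intro bexI[of _ E]) auto
qed

lemma stable_cut:
  fixes c :: bool
  assumes "prob_space M" and stab: "talagrand_stable M A" and U: "ultrafilter U"
    and A: "A \<subseteq> borel_measurable M" and f: "eventually (\<lambda>i. f i \<in> A) U"
    and lim: "\<And>b. b \<in> space M \<Longrightarrow> ((\<lambda>i. f i b) \<longlongrightarrow> p b) U"
  shows "\<exists>X. eventually (\<lambda>i. X i \<in> sets M \<and>
      {b \<in> space M. if c then p b < r \<and> r \<le> f i b else r < p b \<and> f i b \<le> r} \<subseteq> X i) U \<and>
    ((\<lambda>i. measure M (X i)) \<longlongrightarrow> 0) U"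
proof -
  interpret prob_space M by fact
  define S where "S i = {b \<in> space M. if c then r \<le> f i b else f i b \<le> r}" for i
  have S: "eventually (\<lambda>i. S i \<in> sets M) U"
    using f
    by eventually_elim (use A in \<open>cases c; auto simp: S_def intro!: borel_measurable_le\<close>)
  obtain H where H: "H \<in> sets M" "((\<lambda>i. measure M (S i - H)) \<longlongrightarrow> 0) U"
    and null: "\<And>(J :: nat set) V. finite J \<Longrightarrow> V \<in> sets (Pi\<^sub>M J (\<lambda>_. M)) \<Longrightarrow>
        eventually (\<lambda>i. V \<inter> Pi\<^sub>E J (\<lambda>_. S i) = {}) U \<Longrightarrow>
        V \<inter> Pi\<^sub>E J (\<lambda>_. H) \<in> null_sets (Pi\<^sub>M J (\<lambda>_. M))"
    using ultralimit_support[OF prob_space_axioms U S] by blast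
  define N where "N t = {b \<in> H. if c then p b \<le> r - t else r + t \<le> p b}" for t
  have "\<exists>Z\<in>null_sets M. N t \<subseteq> Z" if t: "t > 0" for t
  proof (rule stable_null[where c = c, OF prob_space_axioms stab _ H(1) _ null])
    \<comment> \<open>Half of the gap \<open>t\<close> separates the two levels for stability; the
      other half makes \<open>p\<close> strictly exceed the level, so that \<open>f i\<close>
      eventually does so as well.\<close>
    show "(if c then r - t / 2 else r) < (if c then r else r + t / 2)" using t by simp
    show "N t \<subseteq> H" by (auto simp: N_def)
    fix F assume F: "finite F" "F \<subseteq> N t"
    have "eventually (\<lambda>i. if c then f i b \<le> r - t / 2 else r + t / 2 \<le> f i b) U" if b: "b \<in> F" for b
    proof -
      have bN: "b \<in> N t" using F(2) b by blast
      then have "b \<in> space M" using sets.sets_into_space[OF H(1)] by (auto simp: N_def)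
      note lim = lim[OF this]
      show ?thesis
      proof (cases c)
        case True
        then have "p b < r - t / 2" using bN t by (simp add: N_def)
        from order_tendstoD(2)[OF lim this] show ?thesis by eventually_elim (simp add: True)
      next
        case False
        then have "r + t / 2 < p b" using bN t by (simp add: N_def)
        from order_tendstoD(1)[OF lim this] show ?thesis by eventually_elim (simp add: False)
      qed
    qed
    then have "eventually (\<lambda>i. \<forall>b\<in>F. if c then f i b \<le> r - t / 2 else r + t / 2 \<le> f i b) U"
      using F(1) by (simp add: eventually_ball_finite_distrib)
    with f show "eventually (\<lambda>i. f i \<in> A \<and>
        (\<forall>b\<in>F. if c then f i b \<le> (if c then r - t / 2 else r) else (if c then r else r + t / 2) \<le> f i b) \<and>
        (\<forall>b\<in>S i. if c then (if c then r else r + t / 2) \<le> f i b else f i b \<le> (if c then r - t / 2 else r))) U"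
      by eventually_elim (cases c; simp add: S_def)
  qed auto
  then have "\<forall>n. \<exists>Z. Z \<in> null_sets M \<and> N (1 / Suc n) \<subseteq> Z" by (simp add: Bex_def)
  from choice[OF this] obtain Z where Z: "\<forall>n. Z n \<in> null_sets M \<and> N (1 / Suc n) \<subseteq> Z n" ..
  then have ZU: "(\<Union>n. Z n) \<in> null_sets M" by auto
  have sub: "{b \<in> space M. if c then p b < r \<and> r \<le> f i b else r < p b \<and> f i b \<le> r} \<subseteq> (S i - H) \<union> (\<Union>n. Z n)" for i
  proof (intro subsetI)
    fix b assume b: "b \<in> {b \<in> space M. if c then p b < r \<and> r \<le> f i b else r < p b \<and> f i b \<le> r}"
    then have "\<bar>r - p b\<bar> > 0" by (auto split: if_splits)
    then obtain n where "1 / Suc n < \<bar>r - p b\<bar>" by (rule nat_approx_posE)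
    then have "b \<in> N (1 / Suc n)" if "b \<in> H" using b that by (auto simp: N_def split: if_splits)
    then have "b \<in> Z n" if "b \<in> H" using Z that by blast
    with b show "b \<in> (S i - H) \<union> (\<Union>n. Z n)" by (auto simp: S_def)
  qed
  show ?thesis
  proof (intro exI[of _ "\<lambda>i. (S i - H) \<union> (\<Union>n. Z n)"] conjI)
    show "eventually (\<lambda>i. S i - H \<union> (\<Union>n. Z n) \<in> sets M \<and>
        {b \<in> space M. if c then p b < r \<and> r \<le> f i b else r < p b \<and> f i b \<le> r} \<subseteq> S i - H \<union> (\<Union>n. Z n)) U"
      using S by eventually_elim (use H(1) ZU sub in auto)
    have "eventually (\<lambda>i. measure M (S i - H) = measure M (S i - H \<union> (\<Union>n. Z n))) U"
      using S by eventually_elim (use H(1) ZU in \<open>simp add: measure_Un_null_set\<close>)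
    with H(2) show "((\<lambda>i. measure M (S i - H \<union> (\<Union>n. Z n))) \<longlongrightarrow> 0) U"
      by (rule Lim_transform_eventually)
  qed
qed

section \<open>From cuts to convergence in measure and almost everywhere\<close>

text \<open>The grid consists of the multiples of \<open>\<epsilon>\<close> in a range around
  \<open>[-B, B]\<close>. The largest multiple below \<open>v\<close> serves the first form, the
  smallest above \<open>u\<close> the second; the strict and weak inequalities are placed as in the
  two cases of \<open>stable_cut\<close>.\<close>

lemma finite_separating_grid:
  fixes B \<epsilon> :: real
  assumes "\<epsilon> > 0"
  obtains R where "finite R"
    and "\<And>u v. \<lbrakk>\<bar>u\<bar> \<le> B; \<bar>v\<bar> \<le> B; \<epsilon> \<le> v - u\<rbrakk> \<Longrightarrow> \<exists>r\<in>R. u < r \<and> r \<le> v"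
    and "\<And>u v. \<lbrakk>\<bar>u\<bar> \<le> B; \<bar>v\<bar> \<le> B; \<epsilon> \<le> v - u\<rbrakk> \<Longrightarrow> \<exists>r\<in>R. u \<le> r \<and> r < v"
proof
  define R where "R = (\<lambda>k. \<epsilon> * of_int k) ` {\<lfloor>- B / \<epsilon>\<rfloor>..\<lceil>B / \<epsilon>\<rceil>}"
  show "finite R" by (simp add: R_def)
  fix u v assume uv: "\<bar>u\<bar> \<le> B" "\<bar>v\<bar> \<le> B" "\<epsilon> \<le> v - u"
  have range: "- B / \<epsilon> \<le> w / \<epsilon>" "w / \<epsilon> \<le> B / \<epsilon>" if "\<bar>w\<bar> \<le> B" for w
    using that divide_right_mono[of "- B" w \<epsilon>] divide_right_mono[of w B \<epsilon>] assms by auto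
  define k where "k = \<lfloor>v / \<epsilon>\<rfloor>"
  have "of_int k \<le> v / \<epsilon>" "v / \<epsilon> < of_int k + 1" by (simp_all add: k_def)
  then have "\<epsilon> * of_int k \<le> v" "v < \<epsilon> * of_int k + \<epsilon>"
    using assms by (simp_all add: field_simps)
  moreover have "\<epsilon> * of_int k \<in> R"
    unfolding R_def k_def using range[OF uv(2)]
    by (intro imageI) (auto intro: floor_mono order_trans[OF floor_mono floor_le_ceiling])
  ultimately show "\<exists>r\<in>R. u < r \<and> r \<le> v"
    using uv(3) by (intro bexI[of _ "\<epsilon> * of_int k"]) auto
  define l where "l = \<lceil>u / \<epsilon>\<rceil>"
  have "u / \<epsilon> \<le> of_int l" "of_int l < u / \<epsilon> + 1" using ceiling_correct[of "u / \<epsilon>"] by (simp_all add: l_def)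
  then have "u \<le> \<epsilon> * of_int l" "\<epsilon> * of_int l < u + \<epsilon>"
    using assms by (simp_all add: field_simps)
  moreover have "\<epsilon> * of_int l \<in> R"
    unfolding R_def l_def using range[OF uv(1)]
    by (intro imageI) (auto intro: ceiling_mono order_trans[OF floor_le_ceiling ceiling_mono])
  ultimately show "\<exists>r\<in>R. u \<le> r \<and> r < v"
    using uv(3) by (intro bexI[of _ "\<epsilon> * of_int l"]) auto
qed

text \<open>A deviation of at least \<open>\<epsilon>\<close> in either direction crosses one of the
  finitely many levels of a grid, so it lies in one of finitely many cuts, whose covers have measure
  tending to 0.\<close>

lemma stable_tendsto_in_measure:
  assumes "prob_space M" and stab: "talagrand_stable M A" and U: "ultrafilter U"
    and A: "A \<subseteq> borel_measurable M" and B: "\<And>g b. g \<in> A \<Longrightarrow> b \<in> space M \<Longrightarrow> \<bar>g b\<bar> \<le> B"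
    and f: "eventually (\<lambda>i. f i \<in> A) U"
    and lim: "\<And>b. b \<in> space M \<Longrightarrow> ((\<lambda>i. f i b) \<longlongrightarrow> p b) U"
    and \<epsilon>: "\<epsilon> > 0"
  shows "eventually (\<lambda>i. \<exists>X\<in>sets M. measure M X < \<epsilon> \<and> {b \<in> space M. \<epsilon> \<le> \<bar>f i b - p b\<bar>} \<subseteq> X) U"
proof -
  interpret prob_space M by fact
  have Ub: "U \<noteq> bot" using U by (simp add: ultrafilter_def)
  have pB: "\<bar>p b\<bar> \<le> B" if b: "b \<in> space M" for b
  proof (rule tendsto_upperbound[OF tendsto_rabs[OF lim[OF b]] _ Ub])
    show "eventually (\<lambda>i. \<bar>f i b\<bar> \<le> B) U" using f by eventually_elim (use B b in auto)
  qed
  obtain R where R: "finite R"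
    "\<And>u v. \<lbrakk>\<bar>u\<bar> \<le> B; \<bar>v\<bar> \<le> B; \<epsilon> \<le> v - u\<rbrakk> \<Longrightarrow> \<exists>r\<in>R. u < r \<and> r \<le> v"
    "\<And>u v. \<lbrakk>\<bar>u\<bar> \<le> B; \<bar>v\<bar> \<le> B; \<epsilon> \<le> v - u\<rbrakk> \<Longrightarrow> \<exists>r\<in>R. u \<le> r \<and> r < v"
    using finite_separating_grid[OF \<epsilon>] by blast
  have "\<forall>r. \<exists>X. eventually (\<lambda>i. X i \<in> sets M \<and> {b \<in> space M. p b < r \<and> r \<le> f i b} \<subseteq> X i) U \<and>
      ((\<lambda>i. measure M (X i)) \<longlongrightarrow> 0) U"
    using stable_cut[where c = True and p = p, OF \<open>prob_space M\<close> stab U A f lim] by simp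
  from choice[OF this] obtain X
    where X: "\<And>r. eventually (\<lambda>i. X r i \<in> sets M \<and> {b \<in> space M. p b < r \<and> r \<le> f i b} \<subseteq> X r i) U"
      "\<And>r. ((\<lambda>i. measure M (X r i)) \<longlongrightarrow> 0) U"
    by blast
  have "\<forall>r. \<exists>X. eventually (\<lambda>i. X i \<in> sets M \<and> {b \<in> space M. r < p b \<and> f i b \<le> r} \<subseteq> X i) U \<and>
      ((\<lambda>i. measure M (X i)) \<longlongrightarrow> 0) U"
    using stable_cut[where c = False and p = p, OF \<open>prob_space M\<close> stab U A f lim] by simp
  from choice[OF this] obtain Y
    where Y: "\<And>r. eventually (\<lambda>i. Y r i \<in> sets M \<and> {b \<in> space M. r < p b \<and> f i b \<le> r} \<subseteq> Y r i) U"
      "\<And>r. ((\<lambda>i. measure M (Y r i)) \<longlongrightarrow> 0) U"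
    by blast
  have "((\<lambda>i. \<Sum>r\<in>R. measure M (X r i) + measure M (Y r i)) \<longlongrightarrow> (\<Sum>r\<in>R. 0 + 0)) U"
    by (intro tendsto_sum tendsto_add X Y)
  then have "eventually (\<lambda>i. (\<Sum>r\<in>R. measure M (X r i) + measure M (Y r i)) < \<epsilon>) U"
    using \<epsilon> by (auto dest: order_tendstoD(2))
  moreover have "eventually (\<lambda>i. \<forall>r\<in>R. X r i \<in> sets M \<and> {b \<in> space M. p b < r \<and> r \<le> f i b} \<subseteq> X r i) U"
    "eventually (\<lambda>i. \<forall>r\<in>R. Y r i \<in> sets M \<and> {b \<in> space M. r < p b \<and> f i b \<le> r} \<subseteq> Y r i) U"
    using X(1) Y(1) by (auto intro!: eventually_ball_finite[OF R(1)])
  ultimately show ?thesis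
    using f
  proof eventually_elim
    case (elim i)
    let ?X = "\<Union>r\<in>R. X r i \<union> Y r i"
    have "measure M ?X \<le> (\<Sum>r\<in>R. measure M (X r i \<union> Y r i))"
      using elim R(1) by (intro finite_measure_subadditive_finite) auto
    also have "\<dots> \<le> (\<Sum>r\<in>R. measure M (X r i) + measure M (Y r i))"
      using elim by (intro sum_mono measure_Un_le) auto
    also have "\<dots> < \<epsilon>" using elim by simp
    finally have "measure M ?X < \<epsilon>" .
    moreover have "{b \<in> space M. \<epsilon> \<le> \<bar>f i b - p b\<bar>} \<subseteq> ?X"
    proof
      fix b assume b: "b \<in> {b \<in> space M. \<epsilon> \<le> \<bar>f i b - p b\<bar>}"
      then have bb: "\<bar>p b\<bar> \<le> B" "\<bar>f i b\<bar> \<le> B" using pB B elim by auto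
      from b consider "\<epsilon> \<le> f i b - p b" | "\<epsilon> \<le> p b - f i b"
        by (auto simp: abs_if split: if_splits)
      then show "b \<in> ?X"
      proof cases
        case 1
        then obtain r where "r \<in> R" "p b < r" "r \<le> f i b" using R(2)[OF bb] by auto
        then show ?thesis using elim b by blast
      next
        case 2
        then obtain r where "r \<in> R" "f i b \<le> r" "r < p b" using R(3)[OF bb(2,1)] by auto
        then show ?thesis using elim b by blast
      qed
    qed
    moreover have "?X \<in> sets M" using elim R(1) by (intro sets.finite_UN) auto
    ultimately show ?case by blast
  qed
qed

text \<open>Membership in the closure only provides a filter on \<open>A\<close> converging
  pointwise to \<open>p\<close>. An ultrafilter refining it converges in measure, and from that a
  fast sequence can be extracted.\<close>

lemma stable_closure_AE_limit:
  assumes "prob_space M" and stab: "talagrand_stable M A"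
    and A: "A \<subseteq> borel_measurable M" and B: "\<And>g b. g \<in> A \<Longrightarrow> b \<in> space M \<Longrightarrow> \<bar>g b\<bar> \<le> B"
    and cl: "\<And>F \<epsilon>. finite F \<Longrightarrow> F \<subseteq> space M \<Longrightarrow> \<epsilon> > 0 \<Longrightarrow> \<exists>g\<in>A. \<forall>b\<in>F. \<bar>p b - g b\<bar> < \<epsilon>"
  obtains g :: "nat \<Rightarrow> 'a \<Rightarrow> real" where "\<And>n. g n \<in> A" "AE b in M. (\<lambda>n. g n b) \<longlonglongrightarrow> p b"
proof -
  interpret prob_space M by fact
  \<comment> \<open>the trace on \<open>A\<close> of the pointwise neighbourhoods of \<open>p\<close>\<close>
  let ?G = "\<lambda>(F, n). principal {g \<in> A. \<forall>b\<in>F. \<bar>p b - g b\<bar> < 1 / real (Suc n)}"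
  let ?I = "{F. finite F \<and> F \<subseteq> space M} \<times> (UNIV :: nat set)"
  define \<FF> where "\<FF> = (INF x\<in>?I. ?G x)"
  have base: "eventually P \<FF> \<longleftrightarrow> (\<exists>x\<in>?I. eventually P (?G x))" for P
    unfolding \<FF>_def
  proof (rule eventually_INF_base)
    show "?I \<noteq> {}" by auto
    fix x y assume xy: "x \<in> ?I" "y \<in> ?I"
    obtain F n where x: "x = (F, n)" by force
    obtain F' n' where y: "y = (F', n')" by force
    have "1 / real (Suc (max n n')) \<le> 1 / real (Suc n)" "1 / real (Suc (max n n')) \<le> 1 / real (Suc n')"
      by (auto intro!: divide_left_mono)
    then have "?G (F \<union> F', max n n') \<le> inf (?G x) (?G y)"
      unfolding x y by (auto intro: less_le_trans)
    moreover have "(F \<union> F', max n n') \<in> ?I" using xy x y by auto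
    ultimately show "\<exists>z\<in>?I. ?G z \<le> inf (?G x) (?G y)" by blast
  qed
  have "\<FF> \<noteq> bot"
  proof
    assume "\<FF> = bot"
    then obtain F n where "finite F" "F \<subseteq> space M" "{g \<in> A. \<forall>b\<in>F. \<bar>p b - g b\<bar> < 1 / real (Suc n)} = {}"
      using base[of "\<lambda>_. False"] by (auto simp: eventually_principal)
    with cl[of F "1 / real (Suc n)"] show False by auto
  qed
  then obtain U where U: "U \<le> \<FF>" "ultrafilter U" using ultrafilter_below by blast
  have f: "eventually (\<lambda>g. g \<in> A) U"
    by (rule filter_leD[OF U(1)]) (unfold base, rule bexI[of _ "({}, 0)"], auto simp: eventually_principal)
  have lim: "((\<lambda>g. g b) \<longlongrightarrow> p b) U" if b: "b \<in> space M" for b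
  proof (rule tendstoI)
    fix e :: real assume "e > 0"
    then obtain n where n: "1 / real (Suc n) < e" using nat_approx_posE by metis
    show "eventually (\<lambda>g. dist (g b) (p b) < e) U"
      by (rule filter_leD[OF U(1)], unfold base, rule bexI[of _ "({b}, n)"])
        (use b n in \<open>auto simp: eventually_principal dist_real_def\<close>)
  qed
  have Ub: "U \<noteq> bot" using U(2) by (simp add: ultrafilter_def)
  \<comment> \<open>The ultrafilter lives on the functions themselves, so the family is the
    identity, and an eventual property is realised by some \<open>g\<close> in
    \<open>A\<close>.\<close>
  have "\<exists>g. g \<in> A \<and> (\<exists>X\<in>sets M. measure M X < (1/2)^n \<and> {b \<in> space M. (1/2)^n \<le> \<bar>g b - p b\<bar>} \<subseteq> X)" for n :: nat
  proof -
    have "eventually (\<lambda>g. \<exists>X\<in>sets M. measure M X < (1/2)^n \<and> {b \<in> space M. (1/2)^n \<le> \<bar>g b - p b\<bar>} \<subseteq> X) U"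
      by (rule stable_tendsto_in_measure[where B = B and f = "\<lambda>g. g", OF \<open>prob_space M\<close> stab U(2) A _ f])
        (use B lim in auto)
    from eventually_happens'[OF Ub eventually_conj[OF f this]] show ?thesis .
  qed
  then have "\<forall>n. \<exists>g. g \<in> A \<and> (\<exists>X\<in>sets M. measure M X < (1/2)^n \<and> {b \<in> space M. (1/2)^n \<le> \<bar>g b - p b\<bar>} \<subseteq> X)"
    by blast
  from choice[OF this] obtain g :: "nat \<Rightarrow> 'a \<Rightarrow> real"
    where gA: "\<forall>n. g n \<in> A \<and> (\<exists>X\<in>sets M. measure M X < (1/2)^n \<and> {b \<in> space M. (1/2)^n \<le> \<bar>g n b - p b\<bar>} \<subseteq> X)"
    ..
  then have g: "g n \<in> A" for n by blast
  have "\<forall>n. \<exists>X. X \<in> sets M \<and> measure M X < (1/2)^n \<and> {b \<in> space M. (1/2)^n \<le> \<bar>g n b - p b\<bar>} \<subseteq> X"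
    using gA by blast
  from choice[OF this] obtain X where "\<forall>n. X n \<in> sets M \<and> measure M (X n) < (1/2)^n \<and> {b \<in> space M. (1/2)^n \<le> \<bar>g n b - p b\<bar>} \<subseteq> X n"
    ..
  then have X: "X n \<in> sets M" "measure M (X n) < (1/2)^n"
    and gX: "{b \<in> space M. (1/2)^n \<le> \<bar>g n b - p b\<bar>} \<subseteq> X n" for n
    by blast+
  \<comment> \<open>Borel-Cantelli: the exceptional sets have summable measure, so almost every
    point lies in only finitely many of them.\<close>
  have "AE b in M. eventually (\<lambda>n. b \<in> space M - X n) sequentially"
  proof (rule borel_cantelli_AE1)
    show "summable (\<lambda>n. measure M (X n))"
      by (rule summable_comparison_test'[of "\<lambda>n. (1/2 :: real)^n" 0])
        (use X(2) in \<open>auto intro: less_imp_le\<close>)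
  qed (use X in \<open>auto simp: emeasure_eq_measure\<close>)
  then have "AE b in M. (\<lambda>n. g n b) \<longlonglongrightarrow> p b"
  proof eventually_elim
    case (elim b)
    from elim have ev: "eventually (\<lambda>n. norm (g n b - p b) \<le> (1/2)^n) sequentially"
      by eventually_elim (use gX in \<open>force simp: not_le\<close>)
    have "(\<lambda>n. g n b - p b) \<longlonglongrightarrow> 0"
      by (rule Lim_null_comparison[OF ev]) (rule LIMSEQ_realpow_zero, auto)
    then show ?case by (simp add: LIM_zero_iff)
  qed
  with g show ?thesis by (rule that)
qed

section \<open>Formulas\<close>

lemma eval_coincidence:
  assumes "\<And>n. n \<in> free_vars \<phi> \<Longrightarrow> v n = w n"
  shows "eval M \<phi> v = eval M \<phi> w"
  using assms
proof (induction \<phi> arbitrary: v w)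
  case (Atom R vs)
  then have "(\<lambda>i\<in>{..<length vs}. v (vs ! i)) = (\<lambda>i\<in>{..<length vs}. w (vs ! i))"
    by (intro restrict_ext) auto
  then show ?case by simp
next
  case (Integ z \<phi>)
  have "eval M \<phi> (v(z := a)) = eval M \<phi> (w(z := a))" for a
    by (rule Integ.IH) (use Integ.prems in auto)
  then show ?case by simp
next
  case (Add \<phi>1 \<phi>2)
  then show ?case by (metis UnI1 UnI2 eval.simps(3) free_vars.simps(3))
next
  case (Mult \<phi>1 \<phi>2)
  then show ?case by (metis UnI1 UnI2 eval.simps(5) free_vars.simps(5))
next
  case (Scale c \<phi>)
  then show ?case by (metis eval.simps(4) free_vars.simps(4))
next
  case (Abs \<phi>)
  then show ?case by (metis eval.simps(6) free_vars.simps(6))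
qed simp

text \<open>\<open>val\<close> sends every variable other than its first one to the last argument,
  so the two assignments differ only off the free variables.\<close>

lemma val_commute:
  assumes "x \<noteq> y" and "free_vars \<phi> \<subseteq> {x, y}"
  shows "val M y x \<phi> b a = val M x y \<phi> a b"
  unfolding val_def by (rule eval_coincidence) (use assms in auto)

lemma eval_bounded:
  assumes M: "is_struc L M" and "is_formula L \<phi>" and "\<And>n. v n \<in> universe M"
  shows "\<bar>eval M \<phi> v\<bar> \<le> bound L \<phi>"
  using assms(2,3)
proof (induction \<phi> arbitrary: v)
  case (Atom R vs)
  then have "(\<lambda>i\<in>{..<length vs}. v (vs ! i)) \<in> {..<arity L R} \<rightarrow>\<^sub>E universe M" by auto
  then show ?case using M unfolding is_struc_def by auto
next
  case (Add \<phi>1 \<phi>2)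
  then have "\<bar>eval M \<phi>1 v\<bar> \<le> bound L \<phi>1" "\<bar>eval M \<phi>2 v\<bar> \<le> bound L \<phi>2" by auto
  then show ?case by (auto simp: abs_le_iff)
next
  case (Scale c \<phi>)
  then show ?case by (auto simp: abs_mult intro: mult_left_mono)
next
  case (Mult \<phi>1 \<phi>2)
  then have "\<bar>eval M \<phi>1 v\<bar> \<le> bound L \<phi>1" "\<bar>eval M \<phi>2 v\<bar> \<le> bound L \<phi>2" by auto
  then show ?case by (auto simp: abs_mult intro: mult_mono')
next
  case (Integ z \<phi>)
  interpret prob_space "meas M" using M by (simp add: is_struc_def)
  have b: "\<bar>eval M \<phi> (v(z := a))\<bar> \<le> bound L \<phi>" if "a \<in> universe M" for a
    by (rule Integ.IH) (use Integ.prems that in auto)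
  show ?case
  proof (cases "integrable (meas M) (\<lambda>a. eval M \<phi> (v(z := a)))")
    case True
    have "\<bar>\<integral>a. eval M \<phi> (v(z := a)) \<partial>meas M\<bar> \<le> (\<integral>a. \<bar>eval M \<phi> (v(z := a))\<bar> \<partial>meas M)"
      by (rule integral_abs_bound)
    also have "\<dots> \<le> (\<integral>a. bound L \<phi> \<partial>meas M)"
      using True b by (intro integral_mono) auto
    finally show ?thesis by (simp add: prob_space)
  next
    case False
    \<comment> \<open>A non-integrable function has integral 0 by convention; a single value of the
      integrand shows that the bound is nonnegative.\<close>
    obtain a where "a \<in> universe M" using not_empty by blast
    from b[OF this] show ?thesis using False by (simp add: not_integrable_integral_eq)
  qed
qed auto

text \<open>Measurability in all variables at once is what carries the induction through
  \<open>Integ\<close>: updating an assignment is jointly measurable, so the case becomes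
  measurability of a parametrised integral.\<close>

lemma eval_measurable:
  assumes M: "is_struc L M" and "is_formula L \<phi>"
  shows "eval M \<phi> \<in> borel_measurable (Pi\<^sub>M UNIV (\<lambda>_. meas M))"
  using assms(2)
proof (induction \<phi>)
  case (Atom R vs)
  then have "rel M R \<in> borel_measurable (Pi\<^sub>M {..<length vs} (\<lambda>_. meas M))"
    using M by (metis is_struc_def is_formula.simps(2))
  moreover have "(\<lambda>v. \<lambda>i\<in>{..<length vs}. v (vs ! i)) \<in>
      Pi\<^sub>M UNIV (\<lambda>_. meas M) \<rightarrow>\<^sub>M Pi\<^sub>M {..<length vs} (\<lambda>_. meas M)"
    by measurable
  ultimately have "(\<lambda>v. rel M R (\<lambda>i\<in>{..<length vs}. v (vs ! i))) \<in> borel_measurable (Pi\<^sub>M UNIV (\<lambda>_. meas M))"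
    by (rule measurable_compose[rotated])
  moreover have "eval M (Atom R vs) = (\<lambda>v. rel M R (\<lambda>i\<in>{..<length vs}. v (vs ! i)))" by auto
  ultimately show ?case by (simp only:)
next
  case (Integ z \<phi>)
  interpret prob_space "meas M" using M by (simp add: is_struc_def)
  have [measurable]: "eval M \<phi> \<in> borel_measurable (Pi\<^sub>M UNIV (\<lambda>_. meas M))" using Integ by simp
  have "(\<lambda>(v, a). v(z := a)) \<in> Pi\<^sub>M UNIV (\<lambda>_. meas M) \<Otimes>\<^sub>M meas M \<rightarrow>\<^sub>M Pi\<^sub>M UNIV (\<lambda>_. meas M)"
    using measurable_add_dim[of z UNIV "\<lambda>_. meas M"] by simp
  then have [measurable]: "(\<lambda>(v, a). eval M \<phi> (v(z := a))) \<in> borel_measurable (Pi\<^sub>M UNIV (\<lambda>_. meas M) \<Otimes>\<^sub>M meas M)"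
    by (simp add: case_prod_beta')
  have "(\<lambda>v. \<integral>a. eval M \<phi> (v(z := a)) \<partial>meas M) \<in> borel_measurable (Pi\<^sub>M UNIV (\<lambda>_. meas M))"
    by (rule borel_measurable_lebesgue_integral) measurable
  then show ?case by (simp add: fun_eq_iff cong: measurable_cong)
next
  case (Add \<phi>1 \<phi>2)
  then have "(\<lambda>v. eval M \<phi>1 v + eval M \<phi>2 v) \<in> borel_measurable (Pi\<^sub>M UNIV (\<lambda>_. meas M))" by simp
  then show ?case by (simp cong: measurable_cong)
next
  case (Scale c \<phi>)
  then have "(\<lambda>v. c * eval M \<phi> v) \<in> borel_measurable (Pi\<^sub>M UNIV (\<lambda>_. meas M))" by simp
  then show ?case by (simp cong: measurable_cong)
next
  case (Mult \<phi>1 \<phi>2)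
  then have "(\<lambda>v. eval M \<phi>1 v * eval M \<phi>2 v) \<in> borel_measurable (Pi\<^sub>M UNIV (\<lambda>_. meas M))" by simp
  then show ?case by (simp cong: measurable_cong)
next
  case (Abs \<phi>)
  then have "(\<lambda>v. \<bar>eval M \<phi> v\<bar>) \<in> borel_measurable (Pi\<^sub>M UNIV (\<lambda>_. meas M))" by simp
  then show ?case by (simp cong: measurable_cong)
next
  case One
  then show ?case by (simp cong: measurable_cong)
qed

lemma val_measurable_right:
  assumes "is_struc L M" and "is_formula L \<phi>" and a: "a \<in> universe M"
  shows "(\<lambda>b. val M x y \<phi> a b) \<in> borel_measurable (meas M)"
proof -
  have "(\<lambda>b. (\<lambda>_. b)(x := a)) \<in> meas M \<rightarrow>\<^sub>M Pi\<^sub>M UNIV (\<lambda>_. meas M)"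
    using a by (intro measurable_PiM_single') (auto simp: space_PiM)
  from measurable_compose[OF this eval_measurable[OF assms(1,2)]] show ?thesis by (simp add: val_def)
qed

lemma val_measurable_left:
  assumes "is_struc L M" and "is_formula L \<phi>" and a: "a \<in> universe M"
  shows "(\<lambda>b. val M x y \<phi> b a) \<in> borel_measurable (meas M)"
proof -
  have "(\<lambda>b. (\<lambda>_. a)(x := b)) \<in> meas M \<rightarrow>\<^sub>M Pi\<^sub>M UNIV (\<lambda>_. meas M)"
    using a by (intro measurable_PiM_single') (auto simp: space_PiM)
  from measurable_compose[OF this eval_measurable[OF assms(1,2)]] show ?thesis by (simp add: val_def)
qed

section \<open>Riesz spaces of continuous functions\<close>

lemma riesz_const: "(\<lambda>_. c) \<in> riesz G"
  using riesz.scale[OF riesz.unit, of c] by simp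

lemma riesz_min:
  assumes "g \<in> riesz G" "h \<in> riesz G"
  shows "(\<lambda>q. min (g q) (h q)) \<in> riesz G"
proof -
  have "(\<lambda>q. (-1) * max ((-1) * g q) ((-1) * h q)) \<in> riesz G"
    by (intro riesz.scale riesz.sup assms)
  moreover have "(-1) * max ((-1) * g q) ((-1) * h q) = min (g q) (h q)" for q by (simp add: max_def min_def)
  ultimately show ?thesis by simp
qed

lemma riesz_Max:
  assumes "finite Y" "Y \<noteq> {}" "\<And>y. y \<in> Y \<Longrightarrow> g y \<in> riesz G"
  shows "(\<lambda>q. Max ((\<lambda>y. g y q) ` Y)) \<in> riesz G"
  using assms
proof (induction rule: finite_ne_induct)
  case (insert y Y)
  then have "(\<lambda>q. max (g y q) (Max ((\<lambda>y. g y q) ` Y))) \<in> riesz G" by (intro riesz.sup) auto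
  then show ?case using insert(1,2) by simp
qed simp

lemma riesz_Min:
  assumes "finite Y" "Y \<noteq> {}" "\<And>y. y \<in> Y \<Longrightarrow> g y \<in> riesz G"
  shows "(\<lambda>q. Min ((\<lambda>y. g y q) ` Y)) \<in> riesz G"
  using assms
proof (induction rule: finite_ne_induct)
  case (insert y Y)
  then have "(\<lambda>q. min (g y q) (Min ((\<lambda>y. g y q) ` Y))) \<in> riesz G" by (intro riesz_min) auto
  then show ?case using insert(1,2) by simp
qed simp

lemma riesz_continuous:
  assumes "g \<in> riesz G" and "\<And>h. h \<in> G \<Longrightarrow> continuous_map T euclideanreal h"
  shows "continuous_map T euclideanreal g"
  using assms(1)
  by (induction rule: riesz.induct)
    (auto intro: assms(2) continuous_map_add continuous_map_real_mult_left continuous_map_real_max)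

text \<open>The lattice form of the Stone-Weierstrass theorem. A separating generator and constants
  interpolate \<open>f\<close> at any two points; a finite maximum over a cover stays above
  \<open>f - \<epsilon>\<close> everywhere, and a finite minimum of such maxima also stays below
  \<open>f + \<epsilon>\<close>.\<close>

lemma riesz_dense:
  assumes T: "compact_space T" and G: "\<And>h. h \<in> G \<Longrightarrow> continuous_map T euclideanreal h"
    and sep: "\<And>q q'. \<lbrakk>q \<in> topspace T; q' \<in> topspace T; q \<noteq> q'\<rbrakk> \<Longrightarrow> \<exists>h\<in>G. h q \<noteq> h q'"
    and f: "continuous_map T euclideanreal f" and \<epsilon>: "\<epsilon> > 0"
  shows "\<exists>g\<in>riesz G. \<forall>q\<in>topspace T. \<bar>f q - g q\<bar> < \<epsilon>"
proof (cases "topspace T = {}")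
  case True
  then show ?thesis using riesz.unit by blast
next
  case False
  have interpolate: "\<exists>g\<in>riesz G. g a = f a \<and> g b = f b" if ab: "a \<in> topspace T" "b \<in> topspace T" for a b
  proof (cases "a = b")
    case True
    then show ?thesis using riesz_const by (intro bexI[of _ "\<lambda>_. f a"]) auto
  next
    case False
    then obtain h where h: "h \<in> G" "h a \<noteq> h b" using sep ab by blast
    define c where "c = (f b - f a) / (h b - h a)"
    have c: "c * (h b - h a) = f b - f a" using h(2) by (simp add: c_def)
    have "(\<lambda>q. c * h q + (f a - c * h a)) \<in> riesz G"
      by (intro riesz.add riesz.scale riesz_const riesz.gen h)
    moreover have "c * h b + (f a - c * h a) = f b" using c by (simp add: algebra_simps)
    ultimately show ?thesis by (intro bexI[of _ "\<lambda>q. c * h q + (f a - c * h a)"]) auto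
  qed
  have cover: "\<exists>Y. finite Y \<and> Y \<noteq> {} \<and> Y \<subseteq> topspace T \<and> topspace T \<subseteq> (\<Union>y\<in>Y. V y)"
    if V: "\<And>y. y \<in> topspace T \<Longrightarrow> openin T (V y) \<and> y \<in> V y" for V
  proof -
    have "\<forall>U\<in>V ` topspace T. openin T U" "topspace T \<subseteq> \<Union> (V ` topspace T)" using V by auto
    with T obtain \<F> where "finite \<F>" "\<F> \<subseteq> V ` topspace T" "topspace T \<subseteq> \<Union>\<F>"
      unfolding compact_space_alt by meson
    then obtain Y where "finite Y" "Y \<subseteq> topspace T" "topspace T \<subseteq> (\<Union>y\<in>Y. V y)"
      by (metis finite_subset_image)
    then show ?thesis using False by (intro exI[of _ Y]) auto
  qed
  have opn: "openin T {q \<in> topspace T. g q - f q \<in> W}" if "g \<in> riesz G" "open W" for g W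
    by (rule openin_continuous_map_preimage[of T euclideanreal])
      (use that f riesz_continuous[OF that(1) G] in \<open>auto intro: continuous_map_diff\<close>)
  have above: "\<exists>g\<in>riesz G. g a = f a \<and> (\<forall>q\<in>topspace T. f q - \<epsilon> < g q)" if a: "a \<in> topspace T" for a
  proof -
    obtain g where g: "\<And>b. b \<in> topspace T \<Longrightarrow> g b \<in> riesz G \<and> g b a = f a \<and> g b b = f b"
      using interpolate[OF a] by metis
    have "openin T {q \<in> topspace T. g b q - f q \<in> {- \<epsilon><..}} \<and> b \<in> {q \<in> topspace T. g b q - f q \<in> {- \<epsilon><..}}"
      if "b \<in> topspace T" for b
      using opn[of "g b" "{- \<epsilon><..}"] g[OF that] that \<epsilon> by simp
    from cover[of "\<lambda>b. {q \<in> topspace T. g b q - f q \<in> {- \<epsilon><..}}", OF this] obtain Y where Y: "finite Y" "Y \<noteq> {}" "Y \<subseteq> topspace T"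
      "topspace T \<subseteq> (\<Union>b\<in>Y. {q \<in> topspace T. g b q - f q \<in> {- \<epsilon><..}})"
      by blast
    show ?thesis
    proof (intro bexI conjI ballI)
      show "(\<lambda>q. Max ((\<lambda>y. g y q) ` Y)) \<in> riesz G" using Y g by (intro riesz_Max) auto
      \<comment> \<open>All the interpolants agree with \<open>f\<close> exactly at
        \<open>a\<close>, so the maximum does too. This makes the second cover possible.\<close>
      have "(\<lambda>y. g y a) ` Y = {f a}" using Y(2,3) g by force
      then show "Max ((\<lambda>y. g y a) ` Y) = f a" by simp
      fix q assume "q \<in> topspace T"
      then obtain b where "b \<in> Y" "f q - \<epsilon> < g b q" using Y(4) by fastforce
      then show "f q - \<epsilon> < Max ((\<lambda>y. g y q) ` Y)" using Y(1) by (subst Max_gr_iff) auto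
    qed
  qed
  then obtain g where g: "\<And>a. a \<in> topspace T \<Longrightarrow> g a \<in> riesz G \<and> g a a = f a \<and> (\<forall>q\<in>topspace T. f q - \<epsilon> < g a q)"
    by metis
  have "openin T {q \<in> topspace T. g b q - f q \<in> {..<\<epsilon>}} \<and> b \<in> {q \<in> topspace T. g b q - f q \<in> {..<\<epsilon>}}"
    if "b \<in> topspace T" for b
    using opn[of "g b" "{..<\<epsilon>}"] g[OF that] that \<epsilon> by simp
  from cover[of "\<lambda>b. {q \<in> topspace T. g b q - f q \<in> {..<\<epsilon>}}", OF this] obtain Y where Y: "finite Y" "Y \<noteq> {}" "Y \<subseteq> topspace T"
    "topspace T \<subseteq> (\<Union>b\<in>Y. {q \<in> topspace T. g b q - f q \<in> {..<\<epsilon>}})"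
    by blast
  show ?thesis
  proof (intro bexI ballI)
    show "(\<lambda>q. Min ((\<lambda>y. g y q) ` Y)) \<in> riesz G" using Y g by (intro riesz_Min) auto
    fix q assume q: "q \<in> topspace T"
    then obtain b where "b \<in> Y" "g b q < f q + \<epsilon>" using Y(4) by fastforce
    then have "Min ((\<lambda>y. g y q) ` Y) < f q + \<epsilon>" using Y(1) by (subst Min_less_iff) auto
    moreover have "f q - \<epsilon> < Min ((\<lambda>y. g y q) ` Y)" using Y g q by (subst Min_gr_iff) auto
    ultimately show "\<bar>f q - Min ((\<lambda>y. g y q) ` Y)\<bar> < \<epsilon>" by (simp add: abs_less_iff)
  qed
qed

text \<open>Finite-dimensional open upper orthants form an intersection-stable generator of the
  product \<sigma>-algebra. They are the right generator because an orthant is the positivity set of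
  a function in the Riesz space.\<close>

lemma PiM_borel_law_eqI:
  fixes X :: "'a \<Rightarrow> 'i \<Rightarrow> real" and Y :: "'b \<Rightarrow> 'i \<Rightarrow> real"
  assumes "prob_space P" "prob_space Q"
    and X: "X \<in> P \<rightarrow>\<^sub>M Pi\<^sub>M I (\<lambda>_. borel)" and Y: "Y \<in> Q \<rightarrow>\<^sub>M Pi\<^sub>M I (\<lambda>_. borel)"
    and eq: "\<And>J c. finite J \<Longrightarrow> J \<subseteq> I \<Longrightarrow>
      emeasure P {\<omega> \<in> space P. \<forall>i\<in>J. c i < X \<omega> i} = emeasure Q {\<omega> \<in> space Q. \<forall>i\<in>J. c i < Y \<omega> i}"
  shows "distr P (Pi\<^sub>M I (\<lambda>_. borel)) X = distr Q (Pi\<^sub>M I (\<lambda>_. borel)) Y"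
proof -
  interpret P: prob_space P by fact
  let ?S = "Pi\<^sub>M I (\<lambda>_. borel :: real measure)"
  let ?\<Omega> = "Pi\<^sub>E I (\<lambda>_. UNIV :: real set)"
  define R where "R J c = {q \<in> ?\<Omega>. \<forall>i\<in>J. c i < q i}" for J and c :: "'i \<Rightarrow> real"
  define E where "E = {R J c | J c. finite J \<and> J \<subseteq> I}"
  interpret PX: prob_space "distr P ?S X" by (rule P.prob_space_distr[OF X])
  have sp: "space ?S = ?\<Omega>" by (simp add: space_PiM)
  have RS: "R J c \<in> sets ?S" if J: "finite J" "J \<subseteq> I" for J c
  proof -
    have "{q \<in> space ?S. \<forall>i\<in>J. c i < q i} \<in> sets ?S"
      using J by (intro sets.sets_Collect_finite_All) (auto intro!: borel_measurable_less measurable_component_singleton)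
    then show ?thesis by (simp add: R_def sp)
  qed
  have "sets ?S = sigma_sets ?\<Omega> E"
  proof (rule antisym)
    show "sets ?S \<subseteq> sigma_sets ?\<Omega> E"
    proof -
      have EP: "E \<subseteq> Pow ?\<Omega>" by (auto simp: E_def R_def)
      have "(\<lambda>q. q i) \<in> borel_measurable (sigma ?\<Omega> E)" if i: "i \<in> I" for i
      proof (rule borel_measurableI_greater)
        fix c :: real
        have "R {i} (\<lambda>_. c) \<in> E" using i by (auto simp: E_def)
        moreover have "{q \<in> space (sigma ?\<Omega> E). c < q i} = R {i} (\<lambda>_. c)"
          using EP by (auto simp: R_def)
        ultimately show "{q \<in> space (sigma ?\<Omega> E). c < q i} \<in> sets (sigma ?\<Omega> E)"
          using EP by auto
      qed
      then have "(\<lambda>q. q) \<in> sigma ?\<Omega> E \<rightarrow>\<^sub>M ?S"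
        using EP by (intro measurable_PiM_single') auto
      then have "A \<in> sigma_sets ?\<Omega> E" if "A \<in> sets ?S" for A
        using measurable_sets[OF _ that, of "\<lambda>q. q" "sigma ?\<Omega> E"] EP sets.sets_into_space[OF that]
        by (auto simp: sp Int_absorb2)
      then show ?thesis by blast
    qed
    show "sigma_sets ?\<Omega> E \<subseteq> sets ?S"
      unfolding sp[symmetric] by (rule sets.sigma_sets_subset) (auto simp: E_def RS)
  qed
  then show ?thesis
  proof (intro measure_eqI_generator_eq[where E = E and \<Omega> = ?\<Omega> and A = "\<lambda>_. ?\<Omega>"])
    show "Int_stable E"
    proof (rule Int_stableI)
      fix A B assume "A \<in> E" "B \<in> E"
      then obtain J c K d where A: "A = R J c" "finite J" "J \<subseteq> I" and B: "B = R K d" "finite K" "K \<subseteq> I"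
        by (auto simp: E_def)
      define e where "e i = (if i \<in> J \<and> i \<in> K then max (c i) (d i) else if i \<in> J then c i else d i)" for i
      have "A \<inter> B = R (J \<union> K) e" unfolding A B R_def e_def by auto
      then show "A \<inter> B \<in> E" using A B unfolding E_def by blast
    qed
    show "E \<subseteq> Pow ?\<Omega>" by (auto simp: E_def R_def)
    fix A assume "A \<in> E"
    then obtain J c where A: "A = R J c" and J: "finite J" "J \<subseteq> I" by (auto simp: E_def)
    have "X -` A \<inter> space P = {\<omega> \<in> space P. \<forall>i\<in>J. c i < X \<omega> i}"
      using measurable_space[OF X] by (auto simp: A R_def space_PiM)
    moreover have "Y -` A \<inter> space Q = {\<omega> \<in> space Q. \<forall>i\<in>J. c i < Y \<omega> i}"
      using measurable_space[OF Y] by (auto simp: A R_def space_PiM)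
    ultimately show "emeasure (distr P ?S X) A = emeasure (distr Q ?S Y) A"
      using RS[OF J] X Y eq[OF J] by (simp add: emeasure_distr A)
  next
    have "?\<Omega> = R {} (\<lambda>_. 0)" by (auto simp: R_def)
    then show "range (\<lambda>_. ?\<Omega>) \<subseteq> E" by (auto simp: E_def intro: exI[of _ "{}"])
    show "emeasure (distr P ?S X) ?\<Omega> \<noteq> \<infinity>" by simp
  qed auto
qed

section \<open>Spaces of types and the induced measure\<close>

lemma val_bounded:
  assumes "is_struc L M" and "is_formula L \<phi>" and "a \<in> universe M" and "b \<in> universe M"
  shows "\<bar>val M x y \<phi> a b\<bar> \<le> bound L \<phi>"
  unfolding val_def by (rule eval_bounded[OF assms(1,2)]) (use assms(3,4) in auto)

lemma types_bounded:
  assumes M: "is_struc L M" and \<phi>: "is_formula L \<phi>" and q: "q \<in> types L M x y \<phi>" and b: "b \<in> universe M"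
  shows "\<bar>q b\<bar> \<le> bound L \<phi>"
proof (rule field_le_epsilon)
  fix e :: real assume "e > 0"
  then obtain a where a: "a \<in> universe M" "\<bar>q b - rtp M x y \<phi> a b\<bar> < e"
    using q b unfolding types_eq_closure_realised[OF M \<phi>] in_closure_product_real
    by (metis (no_types, lifting) Int_iff empty_subsetI finite.emptyI finite_insert imageE insertI1 insert_subset)
  moreover have "\<bar>rtp M x y \<phi> a b\<bar> \<le> bound L \<phi>"
    using val_bounded[OF M \<phi> a(1) b] b by (simp add: tp_def)
  ultimately show "\<bar>q b\<bar> \<le> bound L \<phi> + e" by linarith
qed

lemma types_extensional: "q \<in> types L M x y \<phi> \<Longrightarrow> q \<in> extensional (universe M)"
  by (simp add: types_def in_closure_product_real)

lemma topspace_type_top: "topspace (type_top L M x y \<phi>) = types L M x y \<phi>"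
proof -
  have "types L M x y \<phi> \<subseteq> extensional (universe M)" using types_extensional by blast
  then show ?thesis by (auto simp: type_top_def PiE_def)
qed

text \<open>A closed subset of a product of compact intervals, by Tychonoff.\<close>

lemma compact_type_top:
  assumes M: "is_struc L M" and \<phi>: "is_formula L \<phi>"
  shows "compact_space (type_top L M x y \<phi>)"
  unfolding type_top_def
proof (rule compact_space_subtopology, rule closed_compactin)
  show "compactin (product_topology (\<lambda>_. euclideanreal) (universe M))
      (Pi\<^sub>E (universe M) (\<lambda>_. {- bound L \<phi>..bound L \<phi>}))"
    by (simp add: compactin_PiE)
  show "types L M x y \<phi> \<subseteq> Pi\<^sub>E (universe M) (\<lambda>_. {- bound L \<phi>..bound L \<phi>})"
  proof (intro subsetI PiE_I)
    fix q b assume q: "q \<in> types L M x y \<phi>"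
    show "q b \<in> {- bound L \<phi>..bound L \<phi>}" if "b \<in> universe M"
      using types_bounded[OF M \<phi> q that] by (simp add: abs_le_iff minus_le_iff)
    show "q b = undefined" if "b \<notin> universe M"
      using types_extensional[OF q] that by (rule extensional_arb)
  qed
  show "closedin (product_topology (\<lambda>_. euclideanreal) (universe M)) (types L M x y \<phi>)"
    by (simp add: types_def)
qed

lemma continuous_map_type_value:
  assumes "b \<in> universe M"
  shows "continuous_map (type_top L M x y \<phi>) euclideanreal (\<lambda>q. q b)"
  unfolding type_top_def
  by (intro continuous_map_from_subtopology continuous_map_product_projection assms)

lemma rtp_measurable:
  assumes "is_struc L M" and "is_formula L \<phi>"
  shows "rtp M x y \<phi> \<in> meas M \<rightarrow>\<^sub>M Pi\<^sub>M (universe M) (\<lambda>_. borel)"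
proof (rule measurable_PiM_single')
  fix b assume "b \<in> universe M"
  then show "(\<lambda>a. rtp M x y \<phi> a b) \<in> borel_measurable (meas M)"
    using val_measurable_left[OF assms, of b x y] by (simp add: tp_def)
qed (auto simp: tp_def)

section \<open>Transfer between the structure and its space of types\<close>

text \<open>Here the types are types in \<open>x\<close>; the theorem instantiates the locale with
  the two variables exchanged.\<close>

locale induced_types =
  fixes L :: "'r language" and M :: "('r, 'm) struc" and \<phi> :: "'r formula" and x y :: nat
    and \<nu> :: "('m \<Rightarrow> real) measure"
  assumes M: "is_struc L M" and \<phi>: "is_formula L \<phi>" and \<nu>: "induced_measure L M x y \<phi> \<nu>"
begin

abbreviation "T \<equiv> type_top L M x y \<phi>"
abbreviation "S \<equiv> types L M x y \<phi>"
abbreviation "r \<equiv> rtp M x y \<phi>"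
abbreviation "\<P> \<equiv> Pi\<^sub>M (universe M) (\<lambda>_. borel :: real measure)"

interpretation prob_space "meas M" using M by (simp add: is_struc_def)
interpretation \<nu>: prob_space \<nu> using \<nu> by (simp add: induced_measure_def radon_prob_def)

lemma space_induced: "space \<nu> = S"
  using \<nu> by (simp add: induced_measure_def radon_prob_def topspace_type_top)

lemma continuous_measurable:
  assumes f: "continuous_map T euclideanreal f"
  shows "f \<in> borel_measurable \<nu>"
proof (rule borel_measurableI)
  fix W :: "real set" assume "open W"
  with f have "openin T {q \<in> topspace T. f q \<in> W}"
    by (intro openin_continuous_map_preimage[of T euclideanreal]) auto
  moreover have "f -` W \<inter> space \<nu> = {q \<in> topspace T. f q \<in> W}"
    by (auto simp: space_induced topspace_type_top)
  ultimately show "f -` W \<inter> space \<nu> \<in> sets \<nu>"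
    using \<nu> by (auto simp: induced_measure_def radon_prob_def)
qed

text \<open>The universe may be uncountable, so the coordinates may generate fewer sets than the
  open sets do. The identity into \<open>\<P>\<close> serves to restrict \<open>\<nu>\<close> to the
  product \<sigma>-algebra.\<close>

lemma types_measurable: "(\<lambda>q. q) \<in> \<nu> \<rightarrow>\<^sub>M \<P>"
proof (rule measurable_PiM_single')
  show "(\<lambda>q. q) \<in> space \<nu> \<rightarrow> Pi\<^sub>E (universe M) (\<lambda>_. space borel)"
    using types_extensional by (auto simp: space_induced PiE_def)
qed (intro continuous_measurable continuous_map_type_value)

text \<open>The minimum of finitely many functions \<open>q i - c i\<close> belongs to the Riesz
  space, and its positivity set is an orthant, on which \<open>\<nu>\<close> is prescribed.\<close>

lemma induced_law: "distr \<nu> \<P> (\<lambda>q. q) = distr (meas M) \<P> r"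
proof (rule PiM_borel_law_eqI[OF \<nu>.prob_space_axioms prob_space_axioms types_measurable rtp_measurable[OF M \<phi>]])
  fix J and c :: "'m \<Rightarrow> real" assume J: "finite J" "J \<subseteq> universe M"
  then have "\<exists>g\<in>riesz {\<lambda>q. q b | b. b \<in> universe M}. \<forall>q. g q > 0 \<longleftrightarrow> (\<forall>i\<in>J. c i < q i)"
  proof (induction J rule: finite_induct)
    case empty
    then show ?case using riesz.unit by (intro bexI[of _ "\<lambda>_. 1"]) auto
  next
    case (insert j J)
    then obtain g where g: "g \<in> riesz {\<lambda>q. q b | b. b \<in> universe M}" "\<And>q. g q > 0 \<longleftrightarrow> (\<forall>i\<in>J. c i < q i)"
      by auto
    have "(\<lambda>q. q j) \<in> {\<lambda>q. q b | b. b \<in> universe M}" using insert.prems by auto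
    then have "(\<lambda>q. min (q j + - c j) (g q)) \<in> riesz {\<lambda>q. q b | b. b \<in> universe M}"
      by (intro riesz_min riesz.add riesz_const g riesz.gen)
    then show ?case by (rule bexI[rotated]) (auto simp: g(2))
  qed
  then obtain g where g: "g \<in> riesz {\<lambda>q. q b | b. b \<in> universe M}" "\<And>q. g q > 0 \<longleftrightarrow> (\<forall>i\<in>J. c i < q i)"
    by auto
  then show "emeasure \<nu> {q \<in> space \<nu>. \<forall>i\<in>J. c i < q i} = emeasure (meas M) {a \<in> space (meas M). \<forall>i\<in>J. c i < r a i}"
    using \<nu> unfolding induced_measure_def space_induced by (simp flip: g(2))
qed

lemma riesz_measurable:
  assumes "g \<in> riesz {\<lambda>q. q b | b. b \<in> universe M}"
  shows "g \<in> borel_measurable \<P>"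
  using assms by (induction rule: riesz.induct) auto

lemma riesz_approx:
  assumes f: "continuous_map T euclideanreal f" and "\<epsilon> > 0"
  shows "\<exists>g\<in>riesz {\<lambda>q. q b | b. b \<in> universe M}. \<forall>q\<in>S. \<bar>f q - g q\<bar> < \<epsilon>"
  unfolding topspace_type_top[symmetric]
proof (rule riesz_dense[OF compact_type_top[OF M \<phi>] _ _ f \<open>\<epsilon> > 0\<close>])
  fix q q' assume q: "q \<in> topspace T" "q' \<in> topspace T" "q \<noteq> q'"
  then obtain b where "b \<in> universe M" "q b \<noteq> q' b"
    unfolding topspace_type_top by (metis extensionalityI types_extensional)
  then show "\<exists>h\<in>{\<lambda>q. q b | b. b \<in> universe M}. h q \<noteq> h q'"
    by (intro bexI[of _ "\<lambda>q. q b"]) auto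
next
  fix h :: "('m \<Rightarrow> real) \<Rightarrow> real" assume "h \<in> {\<lambda>q. q b | b. b \<in> universe M}"
  then obtain b where "b \<in> universe M" "h = (\<lambda>q. q b)" by blast
  then show "continuous_map T euclideanreal h" by (simp add: continuous_map_type_value)
qed

lemma rtp_types: "a \<in> universe M \<Longrightarrow> r a \<in> S"
  by (rule rtp_in_types[OF M \<phi>])

text \<open>\<open>rtp\<close> is only known to be measurable into the product \<sigma>-algebra, for
  which a continuous \<open>f\<close> need not be measurable. Uniform approximation by
  product-measurable Riesz functions closes the gap.\<close>

lemma continuous_rtp_measurable:
  assumes f: "continuous_map T euclideanreal f"
  shows "(\<lambda>a. f (r a)) \<in> borel_measurable (meas M)"
proof -
  have "\<forall>n. \<exists>g. g \<in> riesz {\<lambda>q. q b | b. b \<in> universe M} \<and> (\<forall>q\<in>S. \<bar>f q - g q\<bar> < 1 / Suc n)"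
    using riesz_approx[OF f] by (simp add: Bex_def)
  from choice[OF this] obtain g where g: "\<And>n. g n \<in> riesz {\<lambda>q. q b | b. b \<in> universe M}"
    and fg: "\<And>n q. q \<in> S \<Longrightarrow> \<bar>f q - g n q\<bar> < 1 / Suc n"
    by blast
  show ?thesis
  proof (rule borel_measurable_LIMSEQ_real[where u = "\<lambda>n a. g n (r a)"])
    show "(\<lambda>a. g n (r a)) \<in> borel_measurable (meas M)" for n
      by (rule measurable_compose[OF rtp_measurable[OF M \<phi>] riesz_measurable[OF g]])
    fix a assume "a \<in> universe M"
    then have "norm (g n (r a) - f (r a)) \<le> 1 / Suc n" for n
      using fg[OF rtp_types, of a n] by (simp add: abs_minus_commute less_imp_le)
    then have "(\<lambda>n. g n (r a) - f (r a)) \<longlonglongrightarrow> 0"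
      by (intro Lim_null_comparison[OF _ lim_inverse_n'[THEN LIMSEQ_Suc]] always_eventually) auto
    then show "(\<lambda>n. g n (r a)) \<longlonglongrightarrow> f (r a)" by (simp add: LIM_zero_iff)
  qed
qed

text \<open>For functions in the Riesz space both integrals are integrals over the common law on
  \<open>\<P>\<close>; uniform approximation carries the equality to \<open>f\<close>.\<close>

lemma integral_induced:
  assumes f: "continuous_map T euclideanreal f" and B: "\<And>q. q \<in> S \<Longrightarrow> \<bar>f q\<bar> \<le> B"
  shows "(\<integral>q. f q \<partial>\<nu>) = (\<integral>a. f (r a) \<partial>meas M)"
proof -
  have "\<bar>(\<integral>q. f q \<partial>\<nu>) - (\<integral>a. f (r a) \<partial>meas M)\<bar> \<le> 0 + e" if e: "e > 0" for e
  proof -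
    obtain g where g: "g \<in> riesz {\<lambda>q. q b | b. b \<in> universe M}" and fg: "\<And>q. q \<in> S \<Longrightarrow> \<bar>f q - g q\<bar> < e / 2"
      using riesz_approx[OF f half_gt_zero[OF e]] by blast
    have gm: "g \<in> borel_measurable \<nu>" "(\<lambda>a. g (r a)) \<in> borel_measurable (meas M)"
      using measurable_compose[OF types_measurable riesz_measurable[OF g]]
        measurable_compose[OF rtp_measurable[OF M \<phi>] riesz_measurable[OF g]] by simp_all
    have gB: "\<bar>g q\<bar> \<le> B + e / 2" if "q \<in> S" for q using fg[OF that] B[OF that] by linarith
    have fB: "\<bar>f q\<bar> \<le> B + e / 2" if "q \<in> S" for q using B[OF that] e by linarith
    have int: "integrable \<nu> f" "integrable \<nu> g"
      using gm gB fB continuous_measurable[OF f]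
      by (auto intro!: \<nu>.integrable_const_bound[of _ "B + e / 2"] AE_I2 simp: space_induced)
    have int': "integrable (meas M) (\<lambda>a. f (r a))" "integrable (meas M) (\<lambda>a. g (r a))"
      using gm gB fB continuous_rtp_measurable[OF f] rtp_types
      by (auto intro!: integrable_const_bound[of _ "B + e / 2"] AE_I2)
    have eq: "(\<integral>q. g q \<partial>\<nu>) = (\<integral>a. g (r a) \<partial>meas M)"
      using integral_distr[OF types_measurable riesz_measurable[OF g]]
        integral_distr[OF rtp_measurable[OF M \<phi>] riesz_measurable[OF g]]
      unfolding induced_law by (rule trans[OF sym])
    have "\<bar>(\<integral>q. f q \<partial>\<nu>) - (\<integral>q. g q \<partial>\<nu>)\<bar> \<le> (\<integral>q. \<bar>f q - g q\<bar> \<partial>\<nu>)"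
      unfolding Bochner_Integration.integral_diff[OF int, symmetric] by (rule integral_abs_bound)
    also have "\<dots> \<le> (\<integral>q. e / 2 \<partial>\<nu>)"
      using int fg by (intro integral_mono) (auto simp: space_induced less_imp_le)
    finally have 1: "\<bar>(\<integral>q. f q \<partial>\<nu>) - (\<integral>q. g q \<partial>\<nu>)\<bar> \<le> e / 2" by (simp add: \<nu>.prob_space)
    have "\<bar>(\<integral>a. f (r a) \<partial>meas M) - (\<integral>a. g (r a) \<partial>meas M)\<bar> \<le> (\<integral>a. \<bar>f (r a) - g (r a)\<bar> \<partial>meas M)"
      unfolding Bochner_Integration.integral_diff[OF int', symmetric] by (rule integral_abs_bound)
    also have "\<dots> \<le> (\<integral>a. e / 2 \<partial>meas M)"
      using int' fg rtp_types by (intro integral_mono) (auto simp: less_imp_le)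
    finally have 2: "\<bar>(\<integral>a. f (r a) \<partial>meas M) - (\<integral>a. g (r a) \<partial>meas M)\<bar> \<le> e / 2" by (simp add: prob_space)
    show ?thesis using 1 2 eq by linarith
  qed
  then have "\<bar>(\<integral>q. f q \<partial>\<nu>) - (\<integral>a. f (r a) \<partial>meas M)\<bar> \<le> 0" by (rule field_le_epsilon)
  then show ?thesis by simp
qed

text \<open>The realised types may form a null set, so behaviour on \<open>M\<close> is transferred
  through integrals. Those of \<open>\<bar>d n\<bar>\<close> over \<open>M\<close> tend to 0 by
  dominated convergence and equal those over \<open>\<nu>\<close>, which tend to the integral of
  \<open>\<bar>\<delta>\<bar>\<close>. The completion enters because \<open>\<delta>\<close> is
  measurable only there.\<close>

lemma AE_induced_zero:
  assumes d: "\<And>n. continuous_map T euclideanreal (d n)" and B: "\<And>n q. q \<in> S \<Longrightarrow> \<bar>d n q\<bar> \<le> B"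
    and \<delta>: "\<delta> \<in> borel_measurable (completion \<nu>)" and lim: "AE q in \<nu>. (\<lambda>n. d n q) \<longlonglongrightarrow> \<delta> q"
    and lim0: "AE a in meas M. (\<lambda>n. d n (r a)) \<longlonglongrightarrow> 0"
  shows "AE q in \<nu>. \<delta> q = 0"
proof -
  have dabs: "continuous_map T euclideanreal (\<lambda>q. \<bar>d n q\<bar>)" for n
    by (rule continuous_map_real_abs[OF d])
  have "(\<lambda>n. \<integral>a. \<bar>d n (r a)\<bar> \<partial>meas M) \<longlonglongrightarrow> (\<integral>a. 0 \<partial>meas M)"
  proof (rule integral_dominated_convergence[where w = "\<lambda>_. B"])
    show "AE a in meas M. (\<lambda>n. \<bar>d n (r a)\<bar>) \<longlonglongrightarrow> 0"
      using lim0 by eventually_elim (rule tendsto_rabs_zero)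
    show "(\<lambda>a. \<bar>d n (r a)\<bar>) \<in> borel_measurable (meas M)" for n
      by (rule continuous_rtp_measurable[OF dabs])
    show "AE a in meas M. norm \<bar>d n (r a)\<bar> \<le> B" for n
      by (rule AE_I2) (simp add: B rtp_types)
  qed simp_all
  then have 1: "(\<lambda>n. \<integral>q. \<bar>d n q\<bar> \<partial>\<nu>) \<longlonglongrightarrow> 0"
    using integral_induced[OF dabs, where B = B] B by simp
  have "(\<lambda>n. \<integral>q. \<bar>d n q\<bar> \<partial>completion \<nu>) \<longlonglongrightarrow> (\<integral>q. \<bar>\<delta> q\<bar> \<partial>completion \<nu>)"
  proof (rule integral_dominated_convergence[where w = "\<lambda>_. B"])
    show "integrable (completion \<nu>) (\<lambda>_. B)"
      by (simp add: integrable_completion)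
    show "AE q in completion \<nu>. (\<lambda>n. \<bar>d n q\<bar>) \<longlonglongrightarrow> \<bar>\<delta> q\<bar>"
      using AE_completion[OF lim] by eventually_elim (rule tendsto_rabs)
    show "(\<lambda>q. \<bar>d n q\<bar>) \<in> borel_measurable (completion \<nu>)" for n
      by (rule measurable_completion[OF continuous_measurable[OF dabs]])
    show "AE q in completion \<nu>. norm \<bar>d n q\<bar> \<le> B" for n
      by (rule AE_I2) (simp add: B space_induced)
    show "(\<lambda>q. \<bar>\<delta> q\<bar>) \<in> borel_measurable (completion \<nu>)"
      using \<delta> by (rule borel_measurable_abs)
  qed
  moreover have "(\<integral>q. \<bar>d n q\<bar> \<partial>completion \<nu>) = (\<integral>q. \<bar>d n q\<bar> \<partial>\<nu>)" for n
    by (rule integral_completion[OF continuous_measurable[OF dabs]])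
  ultimately have "(\<integral>q. \<bar>\<delta> q\<bar> \<partial>completion \<nu>) = 0"
    using LIMSEQ_unique[OF 1] by simp
  moreover have \<delta>B: "AE q in completion \<nu>. \<bar>\<delta> q\<bar> \<le> B"
    using AE_completion[OF lim] AE_space
  proof eventually_elim
    case (elim q)
    then have "(\<lambda>n. \<bar>d n q\<bar>) \<longlonglongrightarrow> \<bar>\<delta> q\<bar>" "q \<in> S" by (auto intro: tendsto_rabs simp: space_induced)
    with B show ?case by (auto intro: LIMSEQ_le_const2)
  qed
  interpret C: prob_space "completion \<nu>" by (rule \<nu>.prob_space_completion)
  have "integrable (completion \<nu>) (\<lambda>q. \<bar>\<delta> q\<bar>)"
    using \<delta> \<delta>B by (intro C.integrable_const_bound[of _ B]) auto
  ultimately have "AE q in completion \<nu>. \<bar>\<delta> q\<bar> = 0"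
    by (subst (asm) integral_nonneg_eq_0_iff_AE) auto
  then show ?thesis by (simp add: AE_completion_iff)
qed

text \<open>Convergence at countably many parameters is an event of the product \<sigma>-algebra,
  where the two laws coincide.\<close>

lemma AE_induced_convergent:
  fixes b :: "nat \<Rightarrow> 'm"
  assumes b: "\<And>n. b n \<in> universe M" and conv: "AE a in meas M. convergent (\<lambda>n. r a (b n))"
  shows "AE q in \<nu>. convergent (\<lambda>n. q (b n))"
proof -
  have m: "{q \<in> space \<P>. convergent (\<lambda>n. q (b n))} \<in> sets \<P>"
    unfolding Cauchy_convergent_iff[symmetric]
    by (intro sets_Collect_Cauchy measurable_component_singleton b)
  have "AE q in distr (meas M) \<P> r. convergent (\<lambda>n. q (b n))"
    using conv by (simp add: AE_distr_iff[OF rtp_measurable[OF M \<phi>] m])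
  then show ?thesis unfolding induced_law[symmetric] by (simp add: AE_distr_iff[OF types_measurable m])
qed

text \<open>On \<open>M\<close> the difference of the two approximating sequences tends to 0, since
  the relations agree there; \<open>AE_induced_zero\<close> applies with twice the bound.\<close>

lemma almost_definable_unique:
  assumes \<psi>: "almost_definable_rel L M x y \<phi> \<nu> \<psi>" and \<psi>': "almost_definable_rel L M x y \<phi> \<nu> \<psi>'"
    and eq: "AE a in meas M. \<psi>' (r a) = \<psi> (r a)"
  shows "AE q in \<nu>. \<psi>' q = \<psi> q"
proof -
  obtain g where g: "\<And>n. continuous_map T euclideanreal (g n)" "\<And>n q. q \<in> S \<Longrightarrow> \<bar>g n q\<bar> \<le> bound L \<phi>"
    "AE q in \<nu>. (\<lambda>n. g n q) \<longlonglongrightarrow> \<psi> q" "AE a in meas M. (\<lambda>n. g n (r a)) \<longlonglongrightarrow> \<psi> (r a)"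
    using \<psi> unfolding almost_definable_rel_def by auto
  obtain h where h: "\<And>n. continuous_map T euclideanreal (h n)" "\<And>n q. q \<in> S \<Longrightarrow> \<bar>h n q\<bar> \<le> bound L \<phi>"
    "AE q in \<nu>. (\<lambda>n. h n q) \<longlonglongrightarrow> \<psi>' q" "AE a in meas M. (\<lambda>n. h n (r a)) \<longlonglongrightarrow> \<psi>' (r a)"
    using \<psi>' unfolding almost_definable_rel_def by auto
  have "AE q in \<nu>. \<psi>' q - \<psi> q = 0"
  proof (rule AE_induced_zero[of "\<lambda>n q. h n q - g n q" "2 * bound L \<phi>"])
    show "continuous_map T euclideanreal (\<lambda>q. h n q - g n q)" for n
      by (rule continuous_map_diff[OF h(1) g(1)])
    show "\<bar>h n q - g n q\<bar> \<le> 2 * bound L \<phi>" if "q \<in> S" for n q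
      using g(2)[OF that, of n] h(2)[OF that, of n] by linarith
    show "(\<lambda>q. \<psi>' q - \<psi> q) \<in> borel_measurable (completion \<nu>)"
      using \<psi> \<psi>' unfolding almost_definable_rel_def by auto
    show "AE q in \<nu>. (\<lambda>n. h n q - g n q) \<longlonglongrightarrow> \<psi>' q - \<psi> q"
      using g(3) h(3) by eventually_elim (rule tendsto_diff)
    show "AE a in meas M. (\<lambda>n. h n (r a) - g n (r a)) \<longlonglongrightarrow> 0"
      using g(4) h(4) eq by eventually_elim (auto dest: tendsto_diff)
  qed
  then show ?thesis by simp
qed

end

section \<open>Existence and uniqueness of the defining relation\<close>

theorem theorem6p5:
  fixes L :: "'r language" and M :: "('r, 'm) struc"
    and \<phi> :: "'r formula" and x y :: nat
    and \<nu> :: "('m \<Rightarrow> real) measure" and p :: "'m \<Rightarrow> real"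
  assumes "is_struc L M"
    and "is_formula L \<phi>" and "x \<noteq> y" and "free_vars \<phi> \<subseteq> {x, y}"
    and "almost_dependent M x y \<phi>"
    and "induced_measure L M y x \<phi> \<nu>"
    and "p \<in> types L M x y \<phi>"
  shows "\<exists>\<psi>. almost_definable_rel L M y x \<phi> \<nu> \<psi> \<and>
             (AE b in meas M. p b = \<psi> (rtp M y x \<phi> b)) \<and>
             (\<forall>\<psi>'. almost_definable_rel L M y x \<phi> \<nu> \<psi>' \<and>
                   (AE b in meas M. p b = \<psi>' (rtp M y x \<phi> b)) \<longrightarrow>
                   (AE q in \<nu>. \<psi>' q = \<psi> q))"
proof -
  note M = assms(1) and \<phi> = assms(2) and \<nu> = assms(6)
  interpret prob_space "meas M" using M by (simp add: is_struc_def)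
  interpret I: induced_types L M \<phi> y x \<nu> by standard (fact M \<phi> \<nu>)+
  let ?A = "sections M x y \<phi>"
  have "\<exists>a :: nat \<Rightarrow> 'm. (\<forall>n. a n \<in> universe M) \<and> (AE b in meas M. (\<lambda>n. val M x y \<phi> (a n) b) \<longlonglongrightarrow> p b)"
  proof -
    \<comment> \<open>The functions \<open>val M x y \<phi> a\<close> have \<open>p\<close> in their
      pointwise closure, and they inherit stability from the full set of sections since
      \<open>D\<close> grows with the set of functions.\<close>
    define A where "A = (\<lambda>a b. val M x y \<phi> a b) ` universe M"
    have sub: "A \<subseteq> ?A" by (auto simp: A_def sections_def)
    have D_sub: "D k A E s r \<subseteq> D k ?A E s r" for k E s r unfolding D_def using sub by blast
    have stab: "talagrand_stable (meas M) A"
      unfolding talagrand_stable_def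
    proof (intro ballI allI impI)
      fix E and s r :: real assume "E \<in> sets (meas M)" "emeasure (meas M) E > 0 \<and> s < r"
      then obtain k where "k \<ge> 1" "outer_measure_of (Pi\<^sub>M {..<2 * k} (\<lambda>_. meas M)) (D k ?A E s r)
          < emeasure (meas M) E ^ (2 * k)"
        using assms(5) unfolding almost_dependent_def by blast
      then show "\<exists>k\<ge>1. outer_measure_of (Pi\<^sub>M {..<2 * k} (\<lambda>_. meas M)) (D k A E s r)
          < emeasure (meas M) E ^ (2 * k)"
        by (intro exI[of _ k] conjI le_less_trans[OF outer_measure_of_mono[OF D_sub]])
    qed
    have Am: "A \<subseteq> borel_measurable (meas M)" using val_measurable_right[OF M \<phi>] by (auto simp: A_def)
    have AB: "\<bar>g b\<bar> \<le> bound L \<phi>" if "g \<in> A" "b \<in> universe M" for g b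
      using that val_bounded[OF M \<phi>] by (auto simp: A_def)
    have cl: "\<exists>g\<in>A. \<forall>b\<in>F. \<bar>p b - g b\<bar> < \<epsilon>" if F: "finite F" "F \<subseteq> universe M" "\<epsilon> > 0" for F \<epsilon>
    proof -
      obtain q where "q \<in> rtp M x y \<phi> ` universe M" "\<forall>b\<in>F. \<bar>p b - q b\<bar> < \<epsilon>"
        using assms(7) F unfolding types_eq_closure_realised[OF M \<phi>] in_closure_product_real by blast
      then obtain a where a: "a \<in> universe M" "\<forall>b\<in>F. \<bar>p b - rtp M x y \<phi> a b\<bar> < \<epsilon>" by blast
      have "\<forall>b\<in>F. \<bar>p b - val M x y \<phi> a b\<bar> < \<epsilon>"
        using a(2) F(2) by (auto simp: tp_def subset_iff)
      with a(1) show ?thesis by (auto simp: A_def)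
    qed
    obtain g where g: "\<And>n :: nat. g n \<in> A" "AE b in meas M. (\<lambda>n. g n b) \<longlonglongrightarrow> p b"
      using stable_closure_AE_limit[where B = "bound L \<phi>" and p = p, OF prob_space_axioms stab Am _ cl] AB by blast
    have "\<forall>n. \<exists>a. a \<in> universe M \<and> g n = val M x y \<phi> a" using g(1) by (auto simp: A_def)
    from choice[OF this] obtain a where "\<forall>n. a n \<in> universe M \<and> g n = val M x y \<phi> (a n)" ..
    with g(2) show ?thesis by auto
  qed
  then obtain a :: "nat \<Rightarrow> 'm" where a: "\<And>n. a n \<in> universe M"
    and lim: "AE b in meas M. (\<lambda>n. val M x y \<phi> (a n) b) \<longlonglongrightarrow> p b"
    by blast
  have rtp_a: "rtp M y x \<phi> b (a n) = val M x y \<phi> (a n) b" for b n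
    using a by (simp add: tp_def val_commute[OF assms(3,4)])
  have limr: "AE b in meas M. (\<lambda>n. rtp M y x \<phi> b (a n)) \<longlonglongrightarrow> p b" using lim by (simp only: rtp_a)
  \<comment> \<open>Evaluation at \<open>a n\<close> is the continuous extension of
    \<open>val M x y \<phi> (a n)\<close> from \<open>M\<close> to the space of types. Where the
    values diverge, \<open>lim\<close> is an arbitrary value, which matters only on null
    sets.\<close>
  define \<psi> where "\<psi> q = lim (\<lambda>n. q (a n))" for q :: "'m \<Rightarrow> real"
  have pq: "AE b in meas M. p b = \<psi> (rtp M y x \<phi> b)"
    using limr by eventually_elim (simp add: \<psi>_def limI)
  have "almost_definable_rel L M y x \<phi> \<nu> \<psi>"
    unfolding almost_definable_rel_def
  proof (intro conjI exI[of _ "\<lambda>n q. q (a n)"] allI ballI)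
    have "\<psi> \<in> borel_measurable \<nu>"
      unfolding \<psi>_def
      by (intro borel_measurable_lim_metric I.continuous_measurable continuous_map_type_value a)
    then show "\<psi> \<in> borel_measurable (completion \<nu>)" by (rule measurable_completion)
    show "AE q in \<nu>. (\<lambda>n. q (a n)) \<longlonglongrightarrow> \<psi> q"
    proof -
      \<comment> \<open>What is transferred to \<open>\<nu>\<close> is the existence of a limit:
        unlike convergence to \<open>p\<close>, it is expressed by the values of the type at the
        points \<open>a n\<close> alone.\<close>
      have "AE b in meas M. convergent (\<lambda>n. rtp M y x \<phi> b (a n))"
        using limr by eventually_elim (rule convergentI)
      from I.AE_induced_convergent[OF a this] show ?thesis
        by eventually_elim (simp add: \<psi>_def convergent_LIMSEQ_iff)
    qed
    show "AE b in meas M. (\<lambda>n. rtp M y x \<phi> b (a n)) \<longlonglongrightarrow> \<psi> (rtp M y x \<phi> b)"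
      using limr pq by eventually_elim simp
  qed (use continuous_map_type_value[OF a] types_bounded[OF M \<phi> _ a] in auto)
  moreover have "AE q in \<nu>. \<psi>' q = \<psi> q"
    if "almost_definable_rel L M y x \<phi> \<nu> \<psi>'" "AE b in meas M. p b = \<psi>' (rtp M y x \<phi> b)" for \<psi>'
    by (rule I.almost_definable_unique[OF calculation that(1)])
      (use that(2) pq in eventually_elim, simp)
  ultimately show ?thesis using pq by blast
qed

end
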